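(* Assume that for every $i\in I$ the right $A$-module $P_i=e_iP$ is finitely generated and projective. Then $(B,A,P,P^\dagger,\eta,\varepsilon)$ is a comatrix coring context, where $\varepsilon:P^\dagger\otimes_BP\to A$ is the restriction of the evaluation map $P^*\otimes_BP\to A$, and $\eta:B\to P\otimes_AP^\dagger$ is the morphism given by $$\eta(b_i)=\sum\sigma_i(b_iz_i)\otimes_A(z_i^*\circ\tau_i)\qquad\text{for all } i\in I,\ b_i\in B_i=e_iBe_i\subset B .$$
   Context: $k$ is a commutative ring and $A$ is a $k$-algebra with unit. A (not necessarily unital) $k$-algebra $R$ is firm if the multiplication $R\otimes_RR\to R$ is an isomorphism; a left $R$-module $N$ is firm if the canonical map $R\otimes_RN\to N$ is an isomorphism (similarly on the right), and bimodules are firm if they are firm on both sides. A comatrix coring context $(B,A,P,P^\dagger,\eta,\varepsilon)$ consists of firm $k$-algebras $B$, $A$, a firm $(B,A)$-bimodule $P$, a firm $(A,B)$-bimodule $P^\dagger$, a $B$-bimodule map $\eta:B\to P\otimes_AP^\dagger$, written $\eta(b)=b^-\otimes_Ab^+$ (summation understood), and an $A$-bimodule map $\varepsilon:P^\dagger\otimes_BP\to A$, such that for all $b\in B$, $p\in P$, $q\in P^\dagger$: $b^-\varepsilon(b^+\otimes_Bp)=bp$ and $\varepsilon(q\otimes_Bb^-)b^+=qb$. A $k$-algebra $B$ has idempotent local units if there is a set of idempotents $\{e_i\mid i\in I\}\subset B$ (indexed without repetition) such that for every finite $F\subset B$ there is $i\in I$ with $e_ib=be_i=b$ for all $b\in F$.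 Fix such a $B$; $I$ is partially ordered by $i\le j$ iff $e_ie_j=e_je_i=e_i$ (a directed order), and $B_i=e_iBe_i$ is a $k$-algebra with unit $e_i$, so $B=\bigcup_iB_i$. $P$ is a firm $(B,A)$-bimodule; $P_i=e_iP$, a $(B_i,A)$-bimodule; $\sigma_i:P_i\to P$ is the inclusion and $\tau_i:P\to P_i$, $\tau_i(p)=e_ip$. $P^*=\operatorname{Hom}_A(P,A)$ and $P_i^*=\operatorname{Hom}_A(P_i,A)$ (right $A$-linear maps), with $(a\varphi b)(p)=a\varphi(bp)$. $P^\dagger=\{\varphi\in P^*\mid\exists i\in I:\ \varphi=\varphi\circ\sigma_i\circ\tau_i\}$, an $(A,B)$-bimodule via $(a\varphi b)(p)=a\varphi(bp)$. $\sum z_i\otimes_Az_i^*\in P_i\otimes_AP_i^*$ (summation index omitted) is the finite dual basis of $P_i$ as a right $A$-module. The right-hand side defining $\eta$ depends only on the element of $B$, not on the choice of $i$. *)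

theory Defs
  imports "HOL-Algebra.Free_Abelian_Groups" "HOL-Algebra.Module"
begin

section \<open>Algebras and bimodules over a commutative base ring\<close>

text \<open>
  Algebras are \<open>module\<close> records over the base ring \<open>K\<close>; the underlying ring need not have a
  unit, so the field \<open>one\<close> is irrelevant unless \<open>ring R\<close> is assumed in addition.
\<close>

locale k_algebra = module K R for K (structure) and R (structure) +
  assumes mult_closed: "\<lbrakk>x \<in> carrier R; y \<in> carrier R\<rbrakk> \<Longrightarrow> x \<otimes>\<^bsub>R\<^esub> y \<in> carrier R"
    and mult_assoc: "\<lbrakk>x \<in> carrier R; y \<in> carrier R; z \<in> carrier R\<rbrakk>
      \<Longrightarrow> (x \<otimes>\<^bsub>R\<^esub> y) \<otimes>\<^bsub>R\<^esub> z = x \<otimes>\<^bsub>R\<^esub> (y \<otimes>\<^bsub>R\<^esub> z)"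
    and mult_l_distr: "\<lbrakk>x \<in> carrier R; y \<in> carrier R; z \<in> carrier R\<rbrakk>
      \<Longrightarrow> (x \<oplus>\<^bsub>R\<^esub> y) \<otimes>\<^bsub>R\<^esub> z = (x \<otimes>\<^bsub>R\<^esub> z) \<oplus>\<^bsub>R\<^esub> (y \<otimes>\<^bsub>R\<^esub> z)"
    and mult_r_distr: "\<lbrakk>x \<in> carrier R; y \<in> carrier R; z \<in> carrier R\<rbrakk>
      \<Longrightarrow> z \<otimes>\<^bsub>R\<^esub> (x \<oplus>\<^bsub>R\<^esub> y) = (z \<otimes>\<^bsub>R\<^esub> x) \<oplus>\<^bsub>R\<^esub> (z \<otimes>\<^bsub>R\<^esub> y)"
    and smult_mult_l: "\<lbrakk>k \<in> carrier K; x \<in> carrier R; y \<in> carrier R\<rbrakk>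
      \<Longrightarrow> (k \<odot>\<^bsub>R\<^esub> x) \<otimes>\<^bsub>R\<^esub> y = k \<odot>\<^bsub>R\<^esub> (x \<otimes>\<^bsub>R\<^esub> y)"
    and smult_mult_r: "\<lbrakk>k \<in> carrier K; x \<in> carrier R; y \<in> carrier R\<rbrakk>
      \<Longrightarrow> x \<otimes>\<^bsub>R\<^esub> (k \<odot>\<^bsub>R\<^esub> y) = k \<odot>\<^bsub>R\<^esub> (x \<otimes>\<^bsub>R\<^esub> y)"

text \<open>
  One record serves for one- and two-sided modules. The inherited fields \<open>mult\<close> and \<open>one\<close> carry
  no meaning, nor does \<open>lact\<close> in a right module or \<open>ract\<close> in a left module.
\<close>

record ('k, 'l, 'm, 'r) bimod = "('k, 'm) module" +
  lact :: "'l \<Rightarrow> 'm \<Rightarrow> 'm"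
  ract :: "'m \<Rightarrow> 'r \<Rightarrow> 'm"

locale left_module = k_algebra K L + M?: module K M
  for K (structure) and L (structure) and M (structure) +
  assumes lact_closed: "\<lbrakk>l \<in> carrier L; m \<in> carrier M\<rbrakk> \<Longrightarrow> lact M l m \<in> carrier M"
    and lact_add_l: "\<lbrakk>l \<in> carrier L; l' \<in> carrier L; m \<in> carrier M\<rbrakk>
      \<Longrightarrow> lact M (l \<oplus>\<^bsub>L\<^esub> l') m = lact M l m \<oplus>\<^bsub>M\<^esub> lact M l' m"
    and lact_add_r: "\<lbrakk>l \<in> carrier L; m \<in> carrier M; m' \<in> carrier M\<rbrakk>
      \<Longrightarrow> lact M l (m \<oplus>\<^bsub>M\<^esub> m') = lact M l m \<oplus>\<^bsub>M\<^esub> lact M l m'"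
    and lact_assoc: "\<lbrakk>l \<in> carrier L; l' \<in> carrier L; m \<in> carrier M\<rbrakk>
      \<Longrightarrow> lact M (l \<otimes>\<^bsub>L\<^esub> l') m = lact M l (lact M l' m)"
    and lact_smult_l: "\<lbrakk>k \<in> carrier K; l \<in> carrier L; m \<in> carrier M\<rbrakk>
      \<Longrightarrow> lact M (k \<odot>\<^bsub>L\<^esub> l) m = k \<odot>\<^bsub>M\<^esub> lact M l m"
    and lact_smult_r: "\<lbrakk>k \<in> carrier K; l \<in> carrier L; m \<in> carrier M\<rbrakk>
      \<Longrightarrow> lact M l (k \<odot>\<^bsub>M\<^esub> m) = k \<odot>\<^bsub>M\<^esub> lact M l m"

locale right_module = k_algebra K R + M?: module K M
  for K (structure) and R (structure) and M (structure) +
  assumes ract_closed: "\<lbrakk>r \<in> carrier R; m \<in> carrier M\<rbrakk> \<Longrightarrow> ract M m r \<in> carrier M"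
    and ract_add_r: "\<lbrakk>r \<in> carrier R; r' \<in> carrier R; m \<in> carrier M\<rbrakk>
      \<Longrightarrow> ract M m (r \<oplus>\<^bsub>R\<^esub> r') = ract M m r \<oplus>\<^bsub>M\<^esub> ract M m r'"
    and ract_add_l: "\<lbrakk>r \<in> carrier R; m \<in> carrier M; m' \<in> carrier M\<rbrakk>
      \<Longrightarrow> ract M (m \<oplus>\<^bsub>M\<^esub> m') r = ract M m r \<oplus>\<^bsub>M\<^esub> ract M m' r"
    and ract_assoc: "\<lbrakk>r \<in> carrier R; r' \<in> carrier R; m \<in> carrier M\<rbrakk>
      \<Longrightarrow> ract M m (r \<otimes>\<^bsub>R\<^esub> r') = ract M (ract M m r) r'"
    and ract_smult_r: "\<lbrakk>k \<in> carrier K; r \<in> carrier R; m \<in> carrier M\<rbrakk>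
      \<Longrightarrow> ract M m (k \<odot>\<^bsub>R\<^esub> r) = k \<odot>\<^bsub>M\<^esub> ract M m r"
    and ract_smult_l: "\<lbrakk>k \<in> carrier K; r \<in> carrier R; m \<in> carrier M\<rbrakk>
      \<Longrightarrow> ract M (k \<odot>\<^bsub>M\<^esub> m) r = k \<odot>\<^bsub>M\<^esub> ract M m r"

locale bimodule = L?: left_module K L M + R?: right_module K R M
  for K (structure) and L (structure) and R (structure) and M (structure) +
  assumes lact_ract: "\<lbrakk>l \<in> carrier L; m \<in> carrier M; r \<in> carrier R\<rbrakk>
      \<Longrightarrow> ract M (lact M l m) r = lact M l (ract M m r)"

locale unital_right_module = right_module +
  assumes ring_R: "ring R"
    and ract_one: "m \<in> carrier M \<Longrightarrow> ract M m \<one>\<^bsub>R\<^esub> = m"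

definition regular :: "('k, 'r) module \<Rightarrow> ('k, 'r, 'r, 'r) bimod" where
  "regular R = \<lparr>carrier = carrier R, mult = mult R, one = one R, zero = zero R, add = add R,
     smult = smult R, lact = mult R, ract = mult R\<rparr>"

definition bimod_hom ::
    "'k ring \<Rightarrow> ('k, 'l) module \<Rightarrow> ('k, 'r) module \<Rightarrow>
     ('k, 'l, 'm, 'r) bimod \<Rightarrow> ('k, 'l, 'n, 'r) bimod \<Rightarrow> ('m \<Rightarrow> 'n) set" where
  "bimod_hom K L R M N = {f \<in> carrier M \<rightarrow> carrier N.
     (\<forall>x\<in>carrier M. \<forall>y\<in>carrier M. f (x \<oplus>\<^bsub>M\<^esub> y) = f x \<oplus>\<^bsub>N\<^esub> f y) \<and>
     (\<forall>k\<in>carrier K. \<forall>x\<in>carrier M. f (k \<odot>\<^bsub>M\<^esub> x) = k \<odot>\<^bsub>N\<^esub> f x) \<and>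
     (\<forall>l\<in>carrier L. \<forall>x\<in>carrier M. f (lact M l x) = lact N l (f x)) \<and>
     (\<forall>r\<in>carrier R. \<forall>x\<in>carrier M. f (ract M x r) = ract N (f x) r)}"

definition bimod_iso ::
    "'k ring \<Rightarrow> ('k, 'l) module \<Rightarrow> ('k, 'r) module \<Rightarrow>
     ('k, 'l, 'm, 'r) bimod \<Rightarrow> ('k, 'l, 'n, 'r) bimod \<Rightarrow> ('m \<Rightarrow> 'n) set" where
  "bimod_iso K L R M N = {f \<in> bimod_hom K L R M N. bij_betw f (carrier M) (carrier N)}"


section \<open>Tensor products\<close>

text \<open>
  \<open>M \<otimes>\<^sub>R N\<close> is the free abelian group on \<open>M \<times> N\<close> modulo the subgroup generated by the relations
  of biadditivity, \<open>K\<close>-balancedness and \<open>R\<close>-balancedness. As \<open>R\<close> need not have a unit,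
  \<open>K\<close>-balancedness is not implied by \<open>R\<close>-balancedness.
\<close>

definition tensor_rels ::
    "'k ring \<Rightarrow> ('k, 'r) module \<Rightarrow> ('k, 'l, 'm, 'r) bimod \<Rightarrow> ('k, 'r, 'n, 's) bimod \<Rightarrow>
     ('m \<times> 'n \<Rightarrow>\<^sub>0 int) set" where
  "tensor_rels K R M N =
     {frag_of (m \<oplus>\<^bsub>M\<^esub> m', n) - frag_of (m, n) - frag_of (m', n) | m m' n.
        m \<in> carrier M \<and> m' \<in> carrier M \<and> n \<in> carrier N} \<union>
     {frag_of (m, n \<oplus>\<^bsub>N\<^esub> n') - frag_of (m, n) - frag_of (m, n') | m n n'.
        m \<in> carrier M \<and> n \<in> carrier N \<and> n' \<in> carrier N} \<union>
     {frag_of (k \<odot>\<^bsub>M\<^esub> m, n) - frag_of (m, k \<odot>\<^bsub>N\<^esub> n) | k m n.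
        k \<in> carrier K \<and> m \<in> carrier M \<and> n \<in> carrier N} \<union>
     {frag_of (ract M m r, n) - frag_of (m, lact N r n) | r m n.
        r \<in> carrier R \<and> m \<in> carrier M \<and> n \<in> carrier N}"

definition tensor_subgroup ::
    "'k ring \<Rightarrow> ('k, 'r) module \<Rightarrow> ('k, 'l, 'm, 'r) bimod \<Rightarrow> ('k, 'r, 'n, 's) bimod \<Rightarrow>
     ('m \<times> 'n \<Rightarrow>\<^sub>0 int) set" where
  "tensor_subgroup K R M N =
     generate (free_Abelian_group (carrier M \<times> carrier N)) (tensor_rels K R M N)"

definition pure ::
    "'k ring \<Rightarrow> ('k, 'r) module \<Rightarrow> ('k, 'l, 'm, 'r) bimod \<Rightarrow> ('k, 'r, 'n, 's) bimod \<Rightarrow>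
     'm \<Rightarrow> 'n \<Rightarrow> ('m \<times> 'n \<Rightarrow>\<^sub>0 int) set" where
  "pure K R M N m n =
     r_coset (free_Abelian_group (carrier M \<times> carrier N)) (tensor_subgroup K R M N) (frag_of (m, n))"

text \<open>The underlying additive group; \<open>mult\<close> and \<open>one\<close> are meaningless.\<close>

definition tensor_group ::
    "'k ring \<Rightarrow> ('k, 'r) module \<Rightarrow> ('k, 'l, 'm, 'r) bimod \<Rightarrow> ('k, 'r, 'n, 's) bimod \<Rightarrow>
     ('m \<times> 'n \<Rightarrow>\<^sub>0 int) set ring" where
  "tensor_group K R M N =
     (let Q = free_Abelian_group (carrier M \<times> carrier N) Mod tensor_subgroup K R M N in
      \<lparr>carrier = carrier Q, mult = undefined, one = undefined, zero = one Q, add = mult Q\<rparr>)"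

text \<open>
  \<open>tensor_lift G f\<close> is the additive map \<open>m \<otimes> n \<mapsto> f m n\<close> into \<open>G\<close>; it is meaningful only for
  balanced \<open>f\<close>, in which case every representative of a coset has the same image
  (lemma \<open>tensor_lift_coset\<close> below).
\<close>

definition frag_eval :: "('x, 'e) ring_scheme \<Rightarrow> ('m \<Rightarrow> 'n \<Rightarrow> 'x) \<Rightarrow> ('m \<times> 'n \<Rightarrow>\<^sub>0 int) \<Rightarrow> 'x" where
  "frag_eval G f c =
     (\<Oplus>\<^bsub>G\<^esub>x\<in>Poly_Mapping.keys c. [Poly_Mapping.lookup c x] \<cdot>\<^bsub>G\<^esub> f (fst x) (snd x))"

definition tensor_lift ::
    "('x, 'e) ring_scheme \<Rightarrow> ('m \<Rightarrow> 'n \<Rightarrow> 'x) \<Rightarrow> ('m \<times> 'n \<Rightarrow>\<^sub>0 int) set \<Rightarrow> 'x" where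
  "tensor_lift G f T = the_elem (frag_eval G f ` T)"

definition tensor ::
    "'k ring \<Rightarrow> ('k, 'r) module \<Rightarrow> ('k, 'l, 'm, 'r) bimod \<Rightarrow> ('k, 'r, 'n, 's) bimod \<Rightarrow>
     ('k, 'l, ('m \<times> 'n \<Rightarrow>\<^sub>0 int) set, 's) bimod" where
  "tensor K R M N = (let G = tensor_group K R M N; t = pure K R M N in
     \<lparr>carrier = carrier G, mult = mult G, one = one G, zero = zero G, add = add G,
      smult = (\<lambda>k. tensor_lift G (\<lambda>m n. t (k \<odot>\<^bsub>M\<^esub> m) n)),
      lact = (\<lambda>l. tensor_lift G (\<lambda>m n. t (lact M l m) n)),
      ract = (\<lambda>T s. tensor_lift G (\<lambda>m n. t m (ract N n s)) T)\<rparr>)"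


section \<open>Firmness and comatrix coring contexts\<close>

definition firm_algebra :: "'k ring \<Rightarrow> ('k, 'r) module \<Rightarrow> bool" where
  "firm_algebra K R \<longleftrightarrow> k_algebra K R \<and>
     tensor_lift R (mult R) \<in> bimod_iso K R R (tensor K R (regular R) (regular R)) (regular R)"

definition firm_bimodule ::
    "'k ring \<Rightarrow> ('k, 'l) module \<Rightarrow> ('k, 'r) module \<Rightarrow> ('k, 'l, 'm, 'r) bimod \<Rightarrow> bool" where
  "firm_bimodule K L R M \<longleftrightarrow> bimodule K L R M \<and>
     tensor_lift M (lact M) \<in> bimod_iso K L R (tensor K L (regular L) M) M \<and>
     tensor_lift M (ract M) \<in> bimod_iso K L R (tensor K R M (regular R)) M"

text \<open>The last two axioms say \<open>b\<^sup>- \<epsilon>(b\<^sup>+ \<otimes> p) = b p\<close> and \<open>\<epsilon>(q \<otimes> b\<^sup>-) b\<^sup>+ = q b\<close> where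
  \<open>\<eta>(b) = b\<^sup>- \<otimes> b\<^sup>+\<close> (summation understood).\<close>

locale comatrix_coring_context =
  fixes K :: "'k ring" and B :: "('k, 'b) module" and A :: "('k, 'a) module"
    and P :: "('k, 'b, 'p, 'a) bimod" and Q :: "('k, 'a, 'q, 'b) bimod"
    and \<eta> :: "'b \<Rightarrow> ('p \<times> 'q \<Rightarrow>\<^sub>0 int) set"
    and \<epsilon> :: "('q \<times> 'p \<Rightarrow>\<^sub>0 int) set \<Rightarrow> 'a"
  assumes firm_B: "firm_algebra K B"
    and firm_A: "firm_algebra K A"
    and firm_P: "firm_bimodule K B A P"
    and firm_Q: "firm_bimodule K A B Q"
    and eta_hom: "\<eta> \<in> bimod_hom K B B (regular B) (tensor K A P Q)"
    and eps_hom: "\<epsilon> \<in> bimod_hom K A A (tensor K B Q P) (regular A)"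
    and eta_eps_P: "\<lbrakk>b \<in> carrier B; p \<in> carrier P\<rbrakk>
      \<Longrightarrow> tensor_lift P (\<lambda>x y. ract P x (\<epsilon> (pure K B Q P y p))) (\<eta> b) = lact P b p"
    and eta_eps_Q: "\<lbrakk>b \<in> carrier B; q \<in> carrier Q\<rbrakk>
      \<Longrightarrow> tensor_lift Q (\<lambda>x y. lact Q (\<epsilon> (pure K B Q P q x)) y) (\<eta> b) = ract Q q b"


section \<open>Right linear maps, duals, finitely generated projective modules\<close>

definition right_hom ::
    "('k, 'r) module \<Rightarrow> ('k, 'l, 'm, 'r) bimod \<Rightarrow> ('k, 'l', 'n, 'r) bimod \<Rightarrow> ('m \<Rightarrow> 'n) set" where
  "right_hom R M N = {f \<in> carrier M \<rightarrow> carrier N.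
     (\<forall>x\<in>carrier M. \<forall>y\<in>carrier M. f (x \<oplus>\<^bsub>M\<^esub> y) = f x \<oplus>\<^bsub>N\<^esub> f y) \<and>
     (\<forall>x\<in>carrier M. \<forall>r\<in>carrier R. f (ract M x r) = ract N (f x) r)}"

text \<open>
  Elements of the dual are made extensional, so that equality of linear forms on the carrier of
  \<open>M\<close> is equality of HOL functions.
\<close>

definition dual :: "('k, 'a) module \<Rightarrow> ('k, 'l, 'm, 'a) bimod \<Rightarrow> ('k, 'a, 'm \<Rightarrow> 'a, 'l) bimod" where
  "dual A M =
     \<lparr>carrier = right_hom A M (regular A) \<inter> extensional (carrier M),
      mult = undefined, one = undefined,
      zero = (\<lambda>p\<in>carrier M. \<zero>\<^bsub>A\<^esub>), add = (\<lambda>\<phi> \<psi>. \<lambda>p\<in>carrier M. \<phi> p \<oplus>\<^bsub>A\<^esub> \<psi> p),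
      smult = (\<lambda>k \<phi>. \<lambda>p\<in>carrier M. k \<odot>\<^bsub>A\<^esub> \<phi> p),
      lact = (\<lambda>a \<phi>. \<lambda>p\<in>carrier M. a \<otimes>\<^bsub>A\<^esub> \<phi> p),
      ract = (\<lambda>\<phi> b. \<lambda>p\<in>carrier M. \<phi> (lact M b p))\<rparr>"

definition right_fin_gen :: "('k, 'a) module \<Rightarrow> ('k, 'l, 'm, 'a) bimod \<Rightarrow> bool" where
  "right_fin_gen A M \<longleftrightarrow> (\<exists>S. finite S \<and> S \<subseteq> carrier M \<and>
     (\<forall>m\<in>carrier M. \<exists>a\<in>S \<rightarrow> carrier A. m = (\<Oplus>\<^bsub>M\<^esub>s\<in>S. ract M s (a s))))"

text \<open>
  Projectivity is the lifting property against surjections \<open>g : X \<rightarrow> Y\<close> of unital right modules.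
  HOL forces \<open>X\<close> and \<open>Y\<close> to live on fixed types. The types below suffice: \<open>'m \<Rightarrow> 'a\<close> carries the
  free module on the elements of \<open>M\<close>, and \<open>'m\<close> carries \<open>M\<close> itself; lemma \<open>right_projective_lift\<close>
  below shows that the lifting property then holds for modules on arbitrary types.
\<close>

definition right_projective ::
    "'k ring \<Rightarrow> ('k, 'a) module \<Rightarrow> ('k, 'l, 'm, 'a) bimod \<Rightarrow> bool" where
  "right_projective K A M \<longleftrightarrow> unital_right_module K A M \<and>
     (\<forall>(X :: ('k, 'l, 'm \<Rightarrow> 'a, 'a) bimod) (Y :: ('k, 'l, 'm, 'a) bimod) g f.
        unital_right_module K A X \<and> unital_right_module K A Y \<and>
        g \<in> right_hom A X Y \<and> g ` carrier X = carrier Y \<and> f \<in> right_hom A M Y \<longrightarrow>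
        (\<exists>h\<in>right_hom A M X. \<forall>m\<in>carrier M. g (h m) = f m))"

text \<open>The pairs \<open>(z j, zs j)\<close>, \<open>j < n\<close>, represent the dual basis element of \<open>M \<otimes>\<^sub>A M\<^sup>*\<close>.\<close>

definition dual_basis ::
    "('k, 'a) module \<Rightarrow> ('k, 'l, 'm, 'a) bimod \<Rightarrow> nat \<Rightarrow> (nat \<Rightarrow> 'm) \<Rightarrow> (nat \<Rightarrow> 'm \<Rightarrow> 'a) \<Rightarrow> bool" where
  "dual_basis A M n z zs \<longleftrightarrow>
     (\<forall>j<n. z j \<in> carrier M \<and> zs j \<in> carrier (dual A M)) \<and>
     (\<forall>p\<in>carrier M. p = (\<Oplus>\<^bsub>M\<^esub>j\<in>{..<n}. ract M (z j) (zs j p)))"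


section \<open>Idempotent local units\<close>

locale idempotent_local_units =
  fixes K :: "'k ring" and B :: "('k, 'b) module" and I :: "'i set" and e :: "'i \<Rightarrow> 'b"
  assumes algebra_B: "k_algebra K B"
    and e_inj: "inj_on e I"
    and e_closed: "i \<in> I \<Longrightarrow> e i \<in> carrier B"
    and e_idem: "i \<in> I \<Longrightarrow> e i \<otimes>\<^bsub>B\<^esub> e i = e i"
    and e_local: "\<lbrakk>finite F; F \<subseteq> carrier B\<rbrakk>
      \<Longrightarrow> \<exists>i\<in>I. \<forall>b\<in>F. e i \<otimes>\<^bsub>B\<^esub> b = b \<and> b \<otimes>\<^bsub>B\<^esub> e i = b"

text \<open>\<open>corner B u\<close> is the unital algebra \<open>uBu\<close> (for idempotent \<open>u\<close>), and \<open>corner_module P u\<close> is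
  \<open>uP\<close> as a \<open>(uBu, A)\<close>-bimodule, with operations inherited from \<open>B\<close> and \<open>P\<close>.\<close>

definition corner :: "('k, 'b) module \<Rightarrow> 'b \<Rightarrow> ('k, 'b) module" where
  "corner B u = B\<lparr>carrier := (\<lambda>b. u \<otimes>\<^bsub>B\<^esub> b \<otimes>\<^bsub>B\<^esub> u) ` carrier B, one := u\<rparr>"

definition corner_module :: "('k, 'b, 'p, 'a) bimod \<Rightarrow> 'b \<Rightarrow> ('k, 'b, 'p, 'a) bimod" where
  "corner_module P u = P\<lparr>carrier := lact P u ` carrier P\<rparr>"

definition corner_incl :: "('k, 'b, 'p, 'a) bimod \<Rightarrow> 'b \<Rightarrow> 'p \<Rightarrow> 'p" where
  "corner_incl P u = (\<lambda>p\<in>carrier (corner_module P u). p)"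

definition corner_proj :: "('k, 'b, 'p, 'a) bimod \<Rightarrow> 'b \<Rightarrow> 'p \<Rightarrow> 'p" where
  "corner_proj P u = (\<lambda>p\<in>carrier P. lact P u p)"

definition dagger ::
    "('k, 'a) module \<Rightarrow> 'i set \<Rightarrow> ('i \<Rightarrow> 'b) \<Rightarrow> ('k, 'b, 'p, 'a) bimod \<Rightarrow>
     ('k, 'a, 'p \<Rightarrow> 'a, 'b) bimod" where
  "dagger A I e P = (dual A P)\<lparr>carrier := {\<phi> \<in> carrier (dual A P).
     \<exists>i\<in>I. \<phi> = compose (carrier P) (compose (carrier (corner_module P (e i))) \<phi> (corner_incl P (e i)))
                 (corner_proj P (e i))}\<rparr>"

text \<open>The composite of the canonical map from the tensor product with \<open>P\<^sup>\<dagger>\<close> to the one with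
  \<open>P\<^sup>*\<close> and evaluation.\<close>

definition eps_map ::
    "'k ring \<Rightarrow> ('k, 'b) module \<Rightarrow> ('k, 'a) module \<Rightarrow> ('k, 'b, 'p, 'a) bimod \<Rightarrow>
     (('p \<Rightarrow> 'a) \<times> 'p \<Rightarrow>\<^sub>0 int) set \<Rightarrow> 'a" where
  "eps_map K B A P T =
     tensor_lift A (\<lambda>\<phi> p. \<phi> p)
       (tensor_lift (tensor K B (dual A P) P) (pure K B (dual A P) P) T)"

definition eta_formula ::
    "'k ring \<Rightarrow> ('k, 'b) module \<Rightarrow> ('k, 'a) module \<Rightarrow> 'i set \<Rightarrow> ('i \<Rightarrow> 'b) \<Rightarrow>
     ('k, 'b, 'p, 'a) bimod \<Rightarrow> ('b \<Rightarrow> ('p \<times> ('p \<Rightarrow> 'a) \<Rightarrow>\<^sub>0 int) set) \<Rightarrow> bool" where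
  "eta_formula K B A I e P \<eta> \<longleftrightarrow>
     (\<forall>i\<in>I. \<forall>b\<in>carrier (corner B (e i)). \<forall>n z zs. dual_basis A (corner_module P (e i)) n z zs \<longrightarrow>
        \<eta> b = (\<Oplus>\<^bsub>tensor K A P (dagger A I e P)\<^esub>j\<in>{..<n}.
          pure K A P (dagger A I e P)
            (corner_incl P (e i) (lact P b (z j)))
            (compose (carrier P) (zs j) (corner_proj P (e i)))))"


section \<open>Adequacy of the tensor product and of projectivity\<close>

definition balanced ::
    "'k ring \<Rightarrow> ('k, 'r) module \<Rightarrow> ('k, 'l, 'm, 'r) bimod \<Rightarrow> ('k, 'r, 'n, 's) bimod \<Rightarrow>
     ('x, 'e) ring_scheme \<Rightarrow> ('m \<Rightarrow> 'n \<Rightarrow> 'x) \<Rightarrow> bool" where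
  "balanced K R M N G f \<longleftrightarrow>
     (\<forall>m\<in>carrier M. \<forall>n\<in>carrier N. f m n \<in> carrier G) \<and>
     (\<forall>m\<in>carrier M. \<forall>m'\<in>carrier M. \<forall>n\<in>carrier N. f (m \<oplus>\<^bsub>M\<^esub> m') n = f m n \<oplus>\<^bsub>G\<^esub> f m' n) \<and>
     (\<forall>m\<in>carrier M. \<forall>n\<in>carrier N. \<forall>n'\<in>carrier N. f m (n \<oplus>\<^bsub>N\<^esub> n') = f m n \<oplus>\<^bsub>G\<^esub> f m n') \<and>
     (\<forall>k\<in>carrier K. \<forall>m\<in>carrier M. \<forall>n\<in>carrier N. f (k \<odot>\<^bsub>M\<^esub> m) n = f m (k \<odot>\<^bsub>N\<^esub> n)) \<and>
     (\<forall>r\<in>carrier R. \<forall>m\<in>carrier M. \<forall>n\<in>carrier N. f (ract M m r) n = f m (lact N r n))"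

lemma frag_eval_superset:
  assumes "abelian_group G" "finite U" "Poly_Mapping.keys c \<subseteq> U"
    and "\<And>x. x \<in> U \<Longrightarrow> f (fst x) (snd x) \<in> carrier G"
  shows "frag_eval G f c =
    (\<Oplus>\<^bsub>G\<^esub>x\<in>U. [Poly_Mapping.lookup c x] \<cdot>\<^bsub>G\<^esub> f (fst x) (snd x))"
proof -
  interpret G: abelian_group G by fact
  have z: "add_pow G (0::int) x = \<zero>\<^bsub>G\<^esub>" for x by (simp add: add_pow_def)
  show ?thesis
    unfolding frag_eval_def
    by (rule G.add.finprod_mono_neutral_cong_left)
       (use assms in \<open>auto simp: in_keys_iff z\<close>)
qed

lemma frag_eval_hom:
  assumes "abelian_group G"
    and f: "\<And>m n. (m, n) \<in> S \<Longrightarrow> f m n \<in> carrier G"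
  shows "frag_eval G f \<in> hom (free_Abelian_group S) (add_monoid G)"
proof (rule homI)
  interpret G: abelian_group G by fact
  fix c assume "c \<in> carrier (free_Abelian_group S)"
  then have *: "Poly_Mapping.keys c \<subseteq> S" by simp
  show "frag_eval G f c \<in> carrier (add_monoid G)"
    unfolding frag_eval_def using * f by (auto intro!: G.finsum_closed)
next
  interpret G: abelian_group G by fact
  fix c d assume "c \<in> carrier (free_Abelian_group S)" "d \<in> carrier (free_Abelian_group S)"
  then have *: "Poly_Mapping.keys c \<subseteq> S" "Poly_Mapping.keys d \<subseteq> S" by simp_all
  let ?U = "Poly_Mapping.keys c \<union> Poly_Mapping.keys d"
  have U: "f (fst x) (snd x) \<in> carrier G" if "x \<in> ?U" for x
    using that * f by (cases x) auto
  have eq: "frag_eval G f c = (\<Oplus>\<^bsub>G\<^esub>x\<in>?U. [Poly_Mapping.lookup c x] \<cdot>\<^bsub>G\<^esub> f (fst x) (snd x))"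
    "frag_eval G f d = (\<Oplus>\<^bsub>G\<^esub>x\<in>?U. [Poly_Mapping.lookup d x] \<cdot>\<^bsub>G\<^esub> f (fst x) (snd x))"
    by (rule frag_eval_superset; use U assms(1) in auto)+
  have "frag_eval G f (c + d) = (\<Oplus>\<^bsub>G\<^esub>x\<in>?U. [Poly_Mapping.lookup (c + d) x] \<cdot>\<^bsub>G\<^esub> f (fst x) (snd x))"
    by (rule frag_eval_superset) (use U assms(1) Poly_Mapping.keys_add[of c d] in auto)
  also have "\<dots> = (\<Oplus>\<^bsub>G\<^esub>x\<in>?U. [Poly_Mapping.lookup c x] \<cdot>\<^bsub>G\<^esub> f (fst x) (snd x)
      \<oplus>\<^bsub>G\<^esub> [Poly_Mapping.lookup d x] \<cdot>\<^bsub>G\<^esub> f (fst x) (snd x))"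
    by (rule G.finsum_cong') (use U in \<open>auto simp: lookup_add G.add.int_pow_mult\<close>)
  also have "\<dots> = frag_eval G f c \<oplus>\<^bsub>G\<^esub> frag_eval G f d"
    unfolding eq using U by (intro G.finsum_addf) (auto intro!: G.add.int_pow_closed)
  finally show "frag_eval G f (c \<otimes>\<^bsub>free_Abelian_group S\<^esub> d)
      = frag_eval G f c \<otimes>\<^bsub>add_monoid G\<^esub> frag_eval G f d" by simp
qed

lemma frag_eval_single:
  assumes "abelian_group G" "f m n \<in> carrier G"
  shows "frag_eval G f (frag_of (m, n)) = f m n"
proof -
  interpret G: abelian_group G by fact
  show ?thesis using assms by (simp add: frag_eval_def G.add.int_pow_1)
qed

lemma tensor_rels_subset:
  assumes "bimodule K L R M" "bimodule K R S N"
  shows "tensor_rels K R M N \<subseteq> carrier (free_Abelian_group (carrier M \<times> carrier N))"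
proof -
  interpret M: bimodule K L R M by fact
  interpret N: bimodule K R S N by fact
  note smM = module.smult_closed[OF M.M.module_axioms] and smN = module.smult_closed[OF N.M.module_axioms]
  have d: "Poly_Mapping.keys (a - b) \<subseteq> T"
    if "Poly_Mapping.keys a \<subseteq> T" "Poly_Mapping.keys b \<subseteq> T"
    for a b :: "'x \<Rightarrow>\<^sub>0 int" and T using that keys_diff[of a b] by blast
  have "Poly_Mapping.keys x \<subseteq> carrier M \<times> carrier N" if "x \<in> tensor_rels K R M N" for x
    using that[unfolded tensor_rels_def]
    by (elim UnE CollectE exE conjE; hypsubst; intro d)
      (auto simp del: keys_single simp: keys_frag_of M.ract_closed N.lact_closed smM smN)
  then show ?thesis by auto
qed

lemma tensor_lift_coset:
  assumes M: "bimodule K L R M" and N: "bimodule K R S N" and G: "abelian_group G"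
    and f: "balanced K R M N G f"
    and c: "c \<in> carrier (free_Abelian_group (carrier M \<times> carrier N))"
  shows "tensor_lift G f (r_coset (free_Abelian_group (carrier M \<times> carrier N))
           (tensor_subgroup K R M N) c) = frag_eval G f c"
proof -
  let ?F = "free_Abelian_group (carrier M \<times> carrier N)"
  interpret G: abelian_group G by fact
  interpret F: comm_group ?F by (rule abelian_free_Abelian_group)
  interpret M: bimodule K L R M by fact
  interpret N: bimodule K R S N by fact
  note smM = module.smult_closed[OF M.M.module_axioms] and smN = module.smult_closed[OF N.M.module_axioms]
  have hom: "frag_eval G f \<in> hom ?F (add_monoid G)"
    by (rule frag_eval_hom[OF G]) (use f in \<open>auto simp: balanced_def\<close>)
  interpret h: group_hom ?F "add_monoid G" "frag_eval G f"
    using hom by unfold_locales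
  have sing: "frag_eval G f (frag_of (m, n)) = f m n" if "m \<in> carrier M" "n \<in> carrier N" for m n
    using that f by (intro frag_eval_single[OF G]) (auto simp: balanced_def)
  have diff: "frag_eval G f (a - b) = frag_eval G f a \<ominus>\<^bsub>G\<^esub> frag_eval G f b"
    if "a \<in> carrier ?F" "b \<in> carrier ?F" for a b
  proof -
    have "frag_eval G f (a \<otimes>\<^bsub>?F\<^esub> inv\<^bsub>?F\<^esub> b) =
       frag_eval G f a \<oplus>\<^bsub>G\<^esub> (\<ominus>\<^bsub>G\<^esub> frag_eval G f b)"
      by (subst h.hom_mult) (use that h.hom_inv[of b] in \<open>auto simp: a_inv_def\<close>)
    then show ?thesis using that by (simp add: G.minus_eq)
  qed
  have rel: "frag_eval G f x = \<zero>\<^bsub>G\<^esub>" if "x \<in> tensor_rels K R M N" for x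
  proof -
    have d: "frag_of (m,n) \<in> carrier ?F" if "m \<in> carrier M" "n \<in> carrier N" for m n
      using that by (auto simp del: keys_single simp: keys_frag_of)
    have dd: "a - b \<in> carrier ?F" if "a \<in> carrier ?F" "b \<in> carrier ?F" for a b
      using that keys_diff[of a b] by auto
    have z: "x \<oplus>\<^bsub>G\<^esub> y \<ominus>\<^bsub>G\<^esub> x \<ominus>\<^bsub>G\<^esub> y = \<zero>\<^bsub>G\<^esub>" if "x \<in> carrier G" "y \<in> carrier G" for x y
      using that by (metis G.add.m_comm G.add.m_assoc G.minus_eq G.r_neg G.r_zero G.a_inv_closed G.a_closed)
    have fc: "f m n \<in> carrier G" if "m \<in> carrier M" "n \<in> carrier N" for m n
      using f that by (auto simp: balanced_def)
    have z': "x \<ominus>\<^bsub>G\<^esub> x = \<zero>\<^bsub>G\<^esub>" if "x \<in> carrier G" for x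
      using that by (simp add: G.minus_eq G.r_neg)
    show ?thesis
      using that f unfolding tensor_rels_def Un_iff
      apply (elim disjE; clarsimp simp del: carrier_free_Abelian_group_iff)
         apply (simp_all add: diff d dd sing M.ract_closed N.lact_closed smM smN
          balanced_def z z' fc del: carrier_free_Abelian_group_iff)
      done
  qed
  have sub: "tensor_subgroup K R M N \<subseteq> kernel ?F (add_monoid G) (frag_eval G f)"
    unfolding tensor_subgroup_def
    by (rule F.generate_subgroup_incl[OF _ h.subgroup_kernel])
       (use rel tensor_rels_subset[OF M N] in \<open>auto simp: kernel_def simp del: carrier_free_Abelian_group_iff\<close>)
  have H: "subgroup (tensor_subgroup K R M N) ?F"
    unfolding tensor_subgroup_def by (rule F.generate_is_subgroup[OF tensor_rels_subset[OF M N]])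
  have "frag_eval G f (x \<otimes>\<^bsub>?F\<^esub> c) = frag_eval G f c" if "x \<in> tensor_subgroup K R M N" for x
    using that sub c h.hom_closed[OF c] by (subst h.hom_mult) (auto simp: kernel_def)
  then have "frag_eval G f ` (r_coset ?F (tensor_subgroup K R M N) c) = {frag_eval G f c}"
    using subgroup.one_closed[OF H] by (fastforce simp: r_coset_def)
  then show ?thesis by (simp add: tensor_lift_def)
qed

corollary tensor_lift_pure:
  assumes "bimodule K L R M" "bimodule K R S N" "abelian_group G" "balanced K R M N G f"
    and "m \<in> carrier M" "n \<in> carrier N"
  shows "tensor_lift G f (pure K R M N m n) = f m n"
proof -
  have "frag_of (m, n) \<in> carrier (free_Abelian_group (carrier M \<times> carrier N))"
    using assms by (auto simp del: keys_single simp: keys_frag_of)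
  moreover have "f m n \<in> carrier G" using assms by (auto simp: balanced_def)
  ultimately show ?thesis
    using assms unfolding pure_def by (simp add: tensor_lift_coset frag_eval_single)
qed

definition free_right :: "('k, 'a) module \<Rightarrow> 'm set \<Rightarrow> ('k, 'l, 'm \<Rightarrow> 'a, 'a) bimod" where
  "free_right A S =
     \<lparr>carrier = {u. (\<forall>x. u x \<in> carrier A) \<and> (\<forall>x. x \<notin> S \<longrightarrow> u x = \<zero>\<^bsub>A\<^esub>) \<and> finite {x. u x \<noteq> \<zero>\<^bsub>A\<^esub>}},
      mult = undefined, one = undefined, zero = (\<lambda>_. \<zero>\<^bsub>A\<^esub>), add = (\<lambda>u v x. u x \<oplus>\<^bsub>A\<^esub> v x),
      smult = (\<lambda>k u x. k \<odot>\<^bsub>A\<^esub> u x), lact = undefined, ract = (\<lambda>u a x. u x \<otimes>\<^bsub>A\<^esub> a)\<rparr>"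

lemma free_right_unital:
  fixes A :: "('k, 'a) module" and S :: "'m set"
  assumes "k_algebra K A" "ring A"
  shows "unital_right_module K A (free_right A S)"
proof -
  interpret kA: k_algebra K A by fact
  interpret A: ring A by fact
  let ?F = "free_right A S"
  have fin: "finite {x. u x \<oplus>\<^bsub>A\<^esub> v x \<noteq> \<zero>\<^bsub>A\<^esub>}"
    if "finite {x. u x \<noteq> \<zero>\<^bsub>A\<^esub>}" "finite {x. v x \<noteq> \<zero>\<^bsub>A\<^esub>}" for u v :: "'m \<Rightarrow> 'a"
    by (rule finite_subset[OF _ finite_UnI[OF that]]) auto
  have fin1: "finite {x. \<ominus>\<^bsub>A\<^esub> u x \<noteq> \<zero>\<^bsub>A\<^esub>}"
    "k \<in> carrier K \<Longrightarrow> finite {x. k \<odot>\<^bsub>A\<^esub> u x \<noteq> \<zero>\<^bsub>A\<^esub>}"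
    "a \<in> carrier A \<Longrightarrow> finite {x. u x \<otimes>\<^bsub>A\<^esub> a \<noteq> \<zero>\<^bsub>A\<^esub>}"
    if "finite {x. u x \<noteq> \<zero>\<^bsub>A\<^esub>}" for u :: "'m \<Rightarrow> 'a" and k a
    by (rule finite_subset[OF _ that]; auto)+
  have "abelian_group ?F"
  proof (rule abelian_groupI)
    fix u assume "u \<in> carrier ?F"
    then show "\<exists>v\<in>carrier ?F. v \<oplus>\<^bsub>?F\<^esub> u = \<zero>\<^bsub>?F\<^esub>"
      by (intro bexI[of _ "\<lambda>x. \<ominus>\<^bsub>A\<^esub> u x"]) (auto simp: free_right_def kA.M.l_neg intro!: fin1)
  qed (auto simp: free_right_def kA.M.a_ac intro!: fin)
  then have mod: "module K ?F"
    by (intro moduleI kA.R.is_cring)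
       (auto simp: free_right_def kA.smult_l_distr kA.smult_r_distr kA.smult_assoc1 intro!: fin1)
  have "right_module K A ?F"
    by (intro right_module.intro right_module_axioms.intro assms mod)
       (auto simp: free_right_def A.r_distr A.l_distr A.m_assoc kA.smult_mult_l kA.smult_mult_r intro!: fin1)
  then show ?thesis
    by (intro unital_right_module.intro unital_right_module_axioms.intro)
       (auto simp: assms(2) free_right_def)
qed

definition lin_ext :: "('k, 'a) module \<Rightarrow> ('k, 'l, 'n, 'a) bimod \<Rightarrow> ('m \<Rightarrow> 'n) \<Rightarrow> ('m \<Rightarrow> 'a) \<Rightarrow> 'n" where
  "lin_ext A X c u = (\<Oplus>\<^bsub>X\<^esub>x\<in>{x. u x \<noteq> \<zero>\<^bsub>A\<^esub>}. ract X (c x) (u x))"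

lemma (in right_module) ract_null: "ring R \<Longrightarrow> m \<in> carrier M \<Longrightarrow> ract M m \<zero>\<^bsub>R\<^esub> = \<zero>\<^bsub>M\<^esub>"
  by (metis M.add.r_cancel_one' M.zero_closed local.ract_add_r ract_closed ring.ring_simprules(2) ring.ring_simprules(15))

lemma (in right_module) ract_null_l: "r \<in> carrier R \<Longrightarrow> ract M \<zero>\<^bsub>M\<^esub> r = \<zero>\<^bsub>M\<^esub>"
  by (metis M.add.r_cancel_one' M.zero_closed M.r_zero ract_add_l ract_closed)

lemma lin_superset:
  assumes "unital_right_module K A X" and c: "\<And>x. x \<in> S \<Longrightarrow> c x \<in> carrier X"
    and u: "u \<in> carrier (free_right A S)" and U: "finite U" "U \<subseteq> S" "{x. u x \<noteq> \<zero>\<^bsub>A\<^esub>} \<subseteq> U"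
  shows "lin_ext A X c u = (\<Oplus>\<^bsub>X\<^esub>x\<in>U. ract X (c x) (u x))"
proof -
  interpret X: unital_right_module K A X by fact
  show ?thesis unfolding lin_ext_def
    by (rule X.M.add.finprod_mono_neutral_cong_left)
       (use assms in \<open>auto simp: free_right_def X.ract_null X.ring_R intro!: X.ract_closed\<close>)
qed

lemma lin_right_hom:
  fixes A :: "('k, 'a) module" and X :: "('k, 'x, 'n, 'a) bimod" and S :: "'m set"
  assumes X: "unital_right_module K A X" and c: "\<And>x. x \<in> S \<Longrightarrow> c x \<in> carrier X"
  shows "lin_ext A X c \<in> right_hom A (free_right A S :: ('k, 'l, 'm \<Rightarrow> 'a, 'a) bimod) X"
proof -
  interpret X: unital_right_module K A X by fact
  interpret A: ring A by (rule X.ring_R)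
  let ?F = "free_right A S :: ('k, 'l, 'm \<Rightarrow> 'a, 'a) bimod"
  interpret F: unital_right_module K A ?F
    by (rule free_right_unital[OF X.k_algebra_axioms X.ring_R])
  have supp: "finite {x. u x \<noteq> \<zero>\<^bsub>A\<^esub>}" "{x. u x \<noteq> \<zero>\<^bsub>A\<^esub>} \<subseteq> S" "u x \<in> carrier A"
    if "u \<in> carrier ?F" for u x
    using that by (auto simp: free_right_def)
  note sup = lin_superset[OF X, of S c]
  have cl: "lin_ext A X c u \<in> carrier X" if "u \<in> carrier ?F" for u
    unfolding lin_ext_def using supp[OF that] c by (intro X.M.finsum_closed) (auto intro!: X.ract_closed)
  have "lin_ext A X c (u \<oplus>\<^bsub>?F\<^esub> v) = lin_ext A X c u \<oplus>\<^bsub>X\<^esub> lin_ext A X c v"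
    if u: "u \<in> carrier ?F" and v: "v \<in> carrier ?F" for u v
  proof -
    let ?U = "{x. u x \<noteq> \<zero>\<^bsub>A\<^esub>} \<union> {x. v x \<noteq> \<zero>\<^bsub>A\<^esub>}"
    have US: "?U \<subseteq> S" "finite ?U" using supp(1,2) u v by auto
    have w: "u \<oplus>\<^bsub>?F\<^esub> v \<in> carrier ?F"
      using F.M.a_closed u v by (simp add: free_right_def)
    have "lin_ext A X c (u \<oplus>\<^bsub>?F\<^esub> v) = (\<Oplus>\<^bsub>X\<^esub>x\<in>?U. ract X (c x) ((u \<oplus>\<^bsub>?F\<^esub> v) x))"
      by (rule sup[OF c w US(2,1)]) (auto simp: free_right_def)
    also have "\<dots> = (\<Oplus>\<^bsub>X\<^esub>x\<in>?U. ract X (c x) (u x) \<oplus>\<^bsub>X\<^esub> ract X (c x) (v x))"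
      using US c supp(3) u v
      by (intro X.M.finsum_cong') (auto simp: free_right_def X.ract_add_r intro!: X.ract_closed X.M.a_closed)
    also have "\<dots> = (\<Oplus>\<^bsub>X\<^esub>x\<in>?U. ract X (c x) (u x)) \<oplus>\<^bsub>X\<^esub> (\<Oplus>\<^bsub>X\<^esub>x\<in>?U. ract X (c x) (v x))"
      using US c supp(3) u v by (intro X.M.finsum_addf) (auto intro!: X.ract_closed)
    also have "\<dots> = lin_ext A X c u \<oplus>\<^bsub>X\<^esub> lin_ext A X c v"
      using sup[OF c u US(2,1)] sup[OF c v US(2,1)] by auto
    finally show ?thesis .
  qed
  moreover have "lin_ext A X c (ract ?F u a) = ract X (lin_ext A X c u) a"
    if u: "u \<in> carrier ?F" and a: "a \<in> carrier A" for u a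
  proof -
    let ?U = "{x. u x \<noteq> \<zero>\<^bsub>A\<^esub>}"
    have w: "ract ?F u a \<in> carrier ?F"
      using F.ract_closed[OF a] u by (simp add: free_right_def)
    have "lin_ext A X c (ract ?F u a) = (\<Oplus>\<^bsub>X\<^esub>x\<in>?U. ract X (c x) (ract ?F u a x))"
      by (rule sup[OF c w]) (use supp(1,2)[OF u] a in \<open>auto simp: free_right_def\<close>)
    also have "\<dots> = (\<Oplus>\<^bsub>X\<^esub>x\<in>?U. ract X (ract X (c x) (u x)) a)"
      using c supp(2,3)[OF u] a
      by (intro X.M.finsum_cong') (auto simp: free_right_def X.ract_assoc subset_iff intro!: X.ract_closed)
    also have "\<dots> = ract X (\<Oplus>\<^bsub>X\<^esub>x\<in>?U. ract X (c x) (u x)) a"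
    proof -
      have "(\<Oplus>\<^bsub>X\<^esub>x\<in>V. ract X (ract X (c x) (u x)) a) = ract X (\<Oplus>\<^bsub>X\<^esub>x\<in>V. ract X (c x) (u x)) a"
        if "finite V" "V \<subseteq> ?U" for V
        using that
      proof (induction V rule: finite_induct)
        case empty
        then show ?case by (simp add: X.ract_null_l a)
      next
        case (insert x V)
        have V: "c y \<in> carrier X" "ract X (c y) (u y) \<in> carrier X" if "y \<in> insert x V" for y
        proof -
          have "y \<in> S" using that insert.prems supp(2)[OF u] by auto
          then have "c y \<in> carrier X" by (rule c)
          then show "c y \<in> carrier X" "ract X (c y) (u y) \<in> carrier X"
            using X.ract_closed supp(3)[OF u] by auto
        qed
        then have "(\<Oplus>\<^bsub>X\<^esub>x\<in>V. ract X (c x) (u x)) \<in> carrier X" by (intro X.M.finsum_closed) auto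
        with insert V a show ?case
          by (simp add: X.M.finsum_insert X.ract_add_l X.ract_closed Pi_def)
      qed
      then show ?thesis using supp(1)[OF u] by blast
    qed
    finally show ?thesis unfolding lin_ext_def .
  qed
  ultimately show ?thesis using cl unfolding right_hom_def by (simp add: free_right_def)
qed

lemma right_hom_lin:
  assumes X: "unital_right_module K A X" and Y: "unital_right_module K A Y"
    and g: "g \<in> right_hom A X Y" and c: "\<And>x. x \<in> S \<Longrightarrow> c x \<in> carrier X"
    and u: "u \<in> carrier (free_right A S)"
  shows "g (lin_ext A X c u) = lin_ext A Y (\<lambda>x. g (c x)) u"
proof -
  interpret X: unital_right_module K A X by fact
  interpret Y: unital_right_module K A Y by fact
  have gc: "g x \<in> carrier Y" if "x \<in> carrier X" for x using g that by (auto simp: right_hom_def)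
  have ga: "g (x \<oplus>\<^bsub>X\<^esub> y) = g x \<oplus>\<^bsub>Y\<^esub> g y" if "x \<in> carrier X" "y \<in> carrier X" for x y
    using g that by (auto simp: right_hom_def)
  have gr: "g (ract X x a) = ract Y (g x) a" if "x \<in> carrier X" "a \<in> carrier A" for x a
    using g that by (auto simp: right_hom_def)
  have g0: "g \<zero>\<^bsub>X\<^esub> = \<zero>\<^bsub>Y\<^esub>"
    by (metis X.M.zero_closed X.M.r_zero Y.M.add.r_cancel_one' ga gc)
  have u': "u x \<in> carrier A" "u x \<noteq> \<zero>\<^bsub>A\<^esub> \<Longrightarrow> x \<in> S" "finite {x. u x \<noteq> \<zero>\<^bsub>A\<^esub>}" for x
    using u by (auto simp: free_right_def)
  have "g (\<Oplus>\<^bsub>X\<^esub>x\<in>V. ract X (c x) (u x)) = (\<Oplus>\<^bsub>Y\<^esub>x\<in>V. ract Y (g (c x)) (u x))"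
    if "finite V" "V \<subseteq> {x. u x \<noteq> \<zero>\<^bsub>A\<^esub>}" for V
    using that
  proof (induction V rule: finite_induct)
    case empty
    then show ?case by (simp add: g0)
  next
    case (insert x V)
    have V: "c y \<in> carrier X" "ract X (c y) (u y) \<in> carrier X" "ract Y (g (c y)) (u y) \<in> carrier Y"
      if "y \<in> insert x V" for y
    proof -
      have "u y \<noteq> \<zero>\<^bsub>A\<^esub>" using that insert.prems by auto
      then have "c y \<in> carrier X" using u'(2) c by simp
      then show "c y \<in> carrier X" "ract X (c y) (u y) \<in> carrier X" "ract Y (g (c y)) (u y) \<in> carrier Y"
        using X.ract_closed Y.ract_closed gc u'(1) by auto
    qed
    then have "(\<Oplus>\<^bsub>X\<^esub>x\<in>V. ract X (c x) (u x)) \<in> carrier X" by (intro X.M.finsum_closed) auto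
    with insert V u'(1) show ?case
      by (simp add: X.M.finsum_insert Y.M.finsum_insert ga gr Pi_def)
  qed
  then show ?thesis unfolding lin_ext_def using u'(3) by blast
qed

theorem right_projective_lift:
  fixes M :: "('k, 'l, 'm, 'a) bimod"
    and X :: "('k, 'l1, 'x, 'a) bimod" and Y :: "('k, 'l2, 'y, 'a) bimod"
  assumes M: "right_projective K A M"
    and X: "unital_right_module K A X" and Y: "unital_right_module K A Y"
    and g: "g \<in> right_hom A X Y" "g ` carrier X = carrier Y" and f: "f \<in> right_hom A M Y"
  shows "\<exists>h\<in>right_hom A M X. \<forall>m\<in>carrier M. g (h m) = f m"
proof -
  interpret M: unital_right_module K A M using M by (simp add: right_projective_def)
  interpret A: ring A by (rule M.ring_R)
  interpret Y: unital_right_module K A Y by fact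
  let ?S = "carrier M"
  let ?F = "free_right A ?S :: ('k, 'l, 'm \<Rightarrow> 'a, 'a) bimod"
  have F: "unital_right_module K A ?F"
    by (rule free_right_unital[OF M.k_algebra_axioms M.ring_R])
  have p: "lin_ext A M (\<lambda>x. x) \<in> right_hom A ?F M"
    by (rule lin_right_hom[OF M.unital_right_module_axioms]) simp
  have onto: "lin_ext A M (\<lambda>x. x) ` carrier ?F = carrier M"
  proof
    show "lin_ext A M (\<lambda>x. x) ` carrier ?F \<subseteq> carrier M" using p by (auto simp: right_hom_def)
    show "carrier M \<subseteq> lin_ext A M (\<lambda>x. x) ` carrier ?F"
    proof
      fix m assume m: "m \<in> carrier M"
      let ?u = "\<lambda>x. if x = m then \<one>\<^bsub>A\<^esub> else \<zero>\<^bsub>A\<^esub>"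
      have u: "?u \<in> carrier ?F" using m by (auto simp: free_right_def)
      have "lin_ext A M (\<lambda>x. x) ?u = (\<Oplus>\<^bsub>M\<^esub>x\<in>{m}. ract M x (?u x))"
        by (rule lin_superset[OF M.unital_right_module_axioms _ u]) (use m in \<open>auto split: if_splits\<close>)
      also have "\<dots> = ract M m \<one>\<^bsub>A\<^esub>"
        using m M.ract_closed[OF A.one_closed m] by (subst M.M.finsum_insert) auto
      finally have "lin_ext A M (\<lambda>x. x) ?u = m" using M.ract_one[OF m] by (rule trans)
      then show "m \<in> lin_ext A M (\<lambda>x. x) ` carrier ?F" using u by (metis image_eqI)
    qed
  qed
  have "(\<lambda>x. x) \<in> right_hom A M M" by (auto simp: right_hom_def)
  then obtain s where s: "s \<in> right_hom A M ?F" "\<And>m. m \<in> carrier M \<Longrightarrow> lin_ext A M (\<lambda>x. x) (s m) = m"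
    using M F p onto M.unital_right_module_axioms unfolding right_projective_def by meson
  have fc: "f x \<in> carrier Y" if "x \<in> carrier M" for x using f that by (auto simp: right_hom_def)
  define c where "c x = (SOME y. y \<in> carrier X \<and> g y = f x)" for x
  have c: "c x \<in> carrier X" "g (c x) = f x" if "x \<in> carrier M" for x
  proof -
    have "\<exists>y. y \<in> carrier X \<and> g y = f x" using g(2) fc[OF that] by (metis imageE)
    from someI_ex[OF this] show "c x \<in> carrier X" "g (c x) = f x" by (auto simp: c_def)
  qed
  have l: "lin_ext A X c \<in> right_hom A ?F X" by (rule lin_right_hom[OF X]) (rule c)
  have "lin_ext A X c \<circ> s \<in> right_hom A M X"
    using l s(1) by (auto simp: right_hom_def Pi_def)
  moreover have "g ((lin_ext A X c \<circ> s) m) = f m" if m: "m \<in> carrier M" for m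
  proof -
    have sm: "s m \<in> carrier ?F" using s(1) m by (auto simp: right_hom_def)
    have "g (lin_ext A X c (s m)) = lin_ext A Y (\<lambda>x. g (c x)) (s m)"
      by (rule right_hom_lin[OF X Y g(1) c(1) sm])
    also have "\<dots> = lin_ext A Y (\<lambda>x. f x) (s m)"
    proof -
      have i: "i \<in> carrier M" "s m i \<in> carrier A" if "s m i \<noteq> \<zero>\<^bsub>A\<^esub>" for i
        using sm that by (auto simp: free_right_def)
      show ?thesis
        unfolding lin_ext_def
        by (rule Y.M.finsum_cong') (use i c(2) fc in \<open>auto intro!: Y.ract_closed\<close>)
    qed
    also have "\<dots> = f (lin_ext A M (\<lambda>x. x) (s m))"
      by (rule right_hom_lin[OF M.unital_right_module_axioms Y f _ sm, symmetric]) simp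
    finally show ?thesis using s(2)[OF m] by simp
  qed
  ultimately show ?thesis by blast
qed

end

theory Submission
  imports Defs
begin

text \<open>
  Choose for every corner \<open>P\<^sub>i\<close> a dual basis and pull its forms back to \<open>P\<close> along
  \<open>p \<mapsto> e\<^sub>i p\<close>. The result is a family \<open>(z\<^sub>j, q\<^sub>j)\<close> in \<open>P \<times> P\<^sup>\<dagger>\<close> with
  \<open>e\<^sub>i p = \<Sum> z\<^sub>j q\<^sub>j(p)\<close> for all \<open>p\<close>; such a family is said to resolve
  \<open>e\<^sub>i\<close> (lemmas \<open>dual_basis_exists\<close> and \<open>dual_basis_resolves\<close>). The formula for \<open>\<eta>\<close> says \<open>\<eta>(b) = \<Sum> b z\<^sub>j \<otimes> q\<^sub>j\<close> whenever \<open>b\<close> lies in the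
  corner \<open>e\<^sub>i B e\<^sub>i\<close>.

  Everything about \<open>\<eta>\<close> comes from one identity (lemma \<open>casimir_transfer\<close>). Let \<open>(z\<^sub>j, q\<^sub>j)\<close> resolve
  \<open>u\<close>, let \<open>(w\<^sub>l, r\<^sub>l)\<close> resolve \<open>v\<close>, and let \<open>v c = c = c u\<close>. Then
  \<open>\<Sum>\<^sub>j c z\<^sub>j \<otimes> q\<^sub>j = \<Sum>\<^sub>l w\<^sub>l \<otimes> r\<^sub>l c\<close>: expand \<open>c z\<^sub>j = v (c z\<^sub>j) = \<Sum>\<^sub>l w\<^sub>l r\<^sub>l(c z\<^sub>j)\<close>, move the scalar
  \<open>r\<^sub>l(c z\<^sub>j)\<close> across the tensor sign, and contract
  \<open>\<Sum>\<^sub>j r\<^sub>l(c z\<^sub>j) q\<^sub>j(p) = r\<^sub>l(c u p) = r\<^sub>l(c p)\<close>. The right-hand side does not mention \<open>(z\<^sub>j, q\<^sub>j)\<close>,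
  so \<open>\<eta>\<close> is well defined even across different corners containing \<open>b\<close>. With \<open>u = v\<close> the identity
  turns \<open>\<Sum> (b b') z\<^sub>j \<otimes> q\<^sub>j\<close>, which is visibly left linear in \<open>b\<close>, into \<open>\<Sum> z\<^sub>j \<otimes> q\<^sub>j (b b')\<close>, which is visibly right linear in \<open>b'\<close>; hence \<open>\<eta>\<close> is a
  bimodule map. Any finite set of elements of \<open>B\<close> lies in one corner, so such computations
  can always be made with a single family. The two axioms of the context are
  \<open>\<Sum> b z\<^sub>j q\<^sub>j(p) = b e\<^sub>i p = b p\<close> and \<open>(\<Sum> q(b z\<^sub>j) q\<^sub>j)(p) = q(b p)\<close>.

  Firmness is a consequence of local units. If \<open>R\<close> has local units, every element \<open>x\<close> of
  \<open>M \<otimes>\<^sub>R R\<close> equals \<open>h(x) \<otimes> u\<close>, where \<open>h\<close> is the action map and \<open>u\<close> is a unit for the finitely many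
  ring elements occurring in \<open>x\<close>, so \<open>h\<close> is injective
  (lemmas \<open>right_action_iso\<close> and \<open>left_action_iso\<close>). This covers \<open>B\<close>, the unital algebra \<open>A\<close> and
  \<open>P\<^sup>\<dagger>\<close>, each of whose forms is fixed by some \<open>e\<^sub>i\<close>. The firmness of \<open>P\<close>, itself one of the
  axioms, also makes the unit of \<open>A\<close> act as the identity on \<open>P\<close>, which forces right \<open>A\<close>-linear forms on \<open>P\<close> to be
  \<open>K\<close>-linear.
\<close>

section \<open>Additive maps and finite sums\<close>

lemma additive_zero:
  assumes "abelian_group G" "abelian_group H" "h \<in> carrier G \<rightarrow> carrier H"
    and "\<And>x y. \<lbrakk>x \<in> carrier G; y \<in> carrier G\<rbrakk> \<Longrightarrow> h (x \<oplus>\<^bsub>G\<^esub> y) = h x \<oplus>\<^bsub>H\<^esub> h y"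
  shows "h \<zero>\<^bsub>G\<^esub> = \<zero>\<^bsub>H\<^esub>"
proof -
  interpret G: abelian_group G by fact
  interpret H: abelian_group H by fact
  show ?thesis
    by (metis G.zero_closed G.r_zero H.add.r_cancel_one' assms(3,4) funcset_mem)
qed

lemma additive_finsum:
  assumes "abelian_group G" "abelian_group H" "h \<in> carrier G \<rightarrow> carrier H"
    and "\<And>x y. \<lbrakk>x \<in> carrier G; y \<in> carrier G\<rbrakk> \<Longrightarrow> h (x \<oplus>\<^bsub>G\<^esub> y) = h x \<oplus>\<^bsub>H\<^esub> h y"
    and "finite U" "\<And>u. u \<in> U \<Longrightarrow> g u \<in> carrier G"
  shows "h (\<Oplus>\<^bsub>G\<^esub>u\<in>U. g u) = (\<Oplus>\<^bsub>H\<^esub>u\<in>U. h (g u))"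
proof -
  interpret G: abelian_group G by fact
  interpret H: abelian_group H by fact
  show ?thesis using assms(5,6)
  proof (induction U rule: finite_induct)
    case empty
    show ?case by (simp add: additive_zero[OF assms(1-4)])
  next
    case (insert u U)
    then show ?case using assms(3)
      by (simp add: assms(4) G.finsum_closed Pi_def)
  qed
qed

lemma finsum_swap:
  assumes "abelian_group G" "finite U" "finite V"
    and g: "\<And>u v. \<lbrakk>u \<in> U; v \<in> V\<rbrakk> \<Longrightarrow> g u v \<in> carrier G"
  shows "(\<Oplus>\<^bsub>G\<^esub>u\<in>U. \<Oplus>\<^bsub>G\<^esub>v\<in>V. g u v) = (\<Oplus>\<^bsub>G\<^esub>v\<in>V. \<Oplus>\<^bsub>G\<^esub>u\<in>U. g u v)"
proof -
  interpret G: abelian_group G by fact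
  show ?thesis using assms(2) g
  proof (induction U rule: finite_induct)
    case empty
    show ?case by simp
  next
    case (insert u U)
    have c: "(\<lambda>v. g u v) \<in> V \<rightarrow> carrier G" "(\<lambda>v. \<Oplus>\<^bsub>G\<^esub>u\<in>U. g u v) \<in> V \<rightarrow> carrier G"
      "(\<lambda>u. \<Oplus>\<^bsub>G\<^esub>v\<in>V. g u v) \<in> U \<rightarrow> carrier G"
      using insert.prems by (auto intro!: G.finsum_closed)
    have "(\<Oplus>\<^bsub>G\<^esub>u\<in>insert u U. \<Oplus>\<^bsub>G\<^esub>v\<in>V. g u v)
        = (\<Oplus>\<^bsub>G\<^esub>v\<in>V. g u v) \<oplus>\<^bsub>G\<^esub> (\<Oplus>\<^bsub>G\<^esub>v\<in>V. \<Oplus>\<^bsub>G\<^esub>u\<in>U. g u v)"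
      using insert c by (simp add: G.finsum_closed)
    also have "\<dots> = (\<Oplus>\<^bsub>G\<^esub>v\<in>V. g u v \<oplus>\<^bsub>G\<^esub> (\<Oplus>\<^bsub>G\<^esub>u\<in>U. g u v))"
      by (rule G.finsum_addf[symmetric]; fact c)
    also have "\<dots> = (\<Oplus>\<^bsub>G\<^esub>v\<in>V. \<Oplus>\<^bsub>G\<^esub>u\<in>insert u U. g u v)"
      using insert c by (intro G.finsum_cong') (auto intro!: G.finsum_closed)
    finally show ?case .
  qed
qed

section \<open>The tensor product as a bimodule\<close>

lemma bimodule_module: "bimodule K L R M \<Longrightarrow> module K M"
  by (simp add: bimodule_def left_module_def)

lemma bimodule_abelian_group: "bimodule K L R M \<Longrightarrow> abelian_group M"
  by (rule module.axioms(2)[OF bimodule_module])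

text \<open>
  The two factors of a tensor product \<open>M \<otimes>\<^sub>R N\<close>, bundled so that the facts about its elements can
  be instantiated once for each of the tensor products in a context.
\<close>

locale bimodule_pair =
  fixes K :: "'k ring" and L :: "('k, 'l) module" and R :: "('k, 'r) module"
    and S :: "('k, 's) module"
    and M :: "('k, 'l, 'm, 'r) bimod" and N :: "('k, 'r, 'n, 's) bimod"
  assumes left: "bimodule K L R M" and right: "bimodule K R S N"
begin

interpretation M: bimodule K L R M by (rule left)
interpretation N: bimodule K R S N by (rule right)

abbreviation "F \<equiv> free_Abelian_group (carrier M \<times> carrier N)"
abbreviation "H \<equiv> tensor_subgroup K R M N"
abbreviation "T \<equiv> tensor K R M N"
abbreviation "G \<equiv> tensor_group K R M N"
abbreviation "t \<equiv> pure K R M N"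

interpretation F: comm_group F by (rule abelian_free_Abelian_group)

lemma subgroup_H: "subgroup H F"
  unfolding tensor_subgroup_def by (rule F.generate_is_subgroup[OF tensor_rels_subset[OF left right]])

interpretation H: normal H F by (rule F.normal_iff_subgroup[THEN iffD2, OF subgroup_H])

lemma carrier_tensor: "carrier T = (\<lambda>c. H #>\<^bsub>F\<^esub> c) ` carrier F"
  by (simp add: tensor_def tensor_group_def Let_def carrier_FactGroup)

lemma add_tensor:
  assumes "c \<in> carrier F" "d \<in> carrier F"
  shows "(H #>\<^bsub>F\<^esub> c) \<oplus>\<^bsub>T\<^esub> (H #>\<^bsub>F\<^esub> d) = H #>\<^bsub>F\<^esub> (c + d)"
  using H.rcos_sum[OF assms] by (simp add: tensor_def tensor_group_def Let_def)

lemma zero_tensor: "\<zero>\<^bsub>T\<^esub> = H #>\<^bsub>F\<^esub> 0"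
  using F.coset_mult_one[OF H.subset] by (simp add: tensor_def tensor_group_def Let_def)

lemma tensor_group_simps: "carrier G = carrier T" "add G = add T" "zero G = zero T"
  by (simp_all add: tensor_def Let_def)

lemma abelian_group_tensor_schemes: "abelian_group T" "abelian_group G"
proof -
  have c: "comm_group (F Mod H)" by (rule F.abelian_FactGroup[OF subgroup_H])
  interpret Q: comm_group "F Mod H" by (rule c)
  have s: "carrier T = carrier (F Mod H)" "add T = mult (F Mod H)" "zero T = one (F Mod H)"
    by (simp_all add: tensor_def tensor_group_def Let_def)
  have inv: "x \<in> carrier (F Mod H) \<Longrightarrow> \<exists>y\<in>carrier (F Mod H). y \<otimes>\<^bsub>F Mod H\<^esub> x = \<one>\<^bsub>F Mod H\<^esub>" for x
    using Q.l_inv_ex by auto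
  show "abelian_group T"
    by (rule abelian_groupI; unfold s) (fact Q.m_closed Q.one_closed Q.m_assoc Q.m_comm Q.l_one inv)+
  show "abelian_group G"
    by (rule abelian_groupI; unfold tensor_group_simps s)
      (fact Q.m_closed Q.one_closed Q.m_assoc Q.m_comm Q.l_one inv)+
qed

interpretation T: abelian_group T by (rule abelian_group_tensor_schemes)

lemma gen_closed: "\<lbrakk>m \<in> carrier M; n \<in> carrier N\<rbrakk> \<Longrightarrow> frag_of (m, n) \<in> carrier F"
  by (simp del: keys_single carrier_free_Abelian_group_iff)

lemma pure_closed: "\<lbrakk>m \<in> carrier M; n \<in> carrier N\<rbrakk> \<Longrightarrow> t m n \<in> carrier T"
  using gen_closed unfolding carrier_tensor pure_def by blast

lemma coset_eqI:
  assumes "c \<in> carrier F" "d \<in> carrier F" "c - d \<in> tensor_rels K R M N"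
  shows "H #>\<^bsub>F\<^esub> c = H #>\<^bsub>F\<^esub> d"
proof -
  have "c - d \<in> H" unfolding tensor_subgroup_def by (rule generate.incl) fact
  then have "c \<in> H #>\<^bsub>F\<^esub> d" unfolding r_coset_def by force
  then show ?thesis using F.repr_independence[OF _ assms(2) subgroup_H] by simp
qed

lemma plus_closed: "\<lbrakk>c \<in> carrier F; d \<in> carrier F\<rbrakk> \<Longrightarrow> c + d \<in> carrier F"
  using F.m_closed[of c d] by simp

lemma pure_add_l:
  assumes "m \<in> carrier M" "m' \<in> carrier M" "n \<in> carrier N"
  shows "t (m \<oplus>\<^bsub>M\<^esub> m') n = t m n \<oplus>\<^bsub>T\<^esub> t m' n"
proof -
  have "frag_of (m \<oplus>\<^bsub>M\<^esub> m', n) - frag_of (m, n) - frag_of (m', n) \<in> tensor_rels K R M N"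
    unfolding tensor_rels_def using assms by blast
  then have "H #>\<^bsub>F\<^esub> frag_of (m \<oplus>\<^bsub>M\<^esub> m', n) = H #>\<^bsub>F\<^esub> (frag_of (m, n) + frag_of (m', n))"
    by (intro coset_eqI gen_closed plus_closed) (simp_all add: assms diff_diff_add)
  then show ?thesis unfolding pure_def using assms by (simp only: add_tensor gen_closed)
qed

lemma pure_add_r:
  assumes "m \<in> carrier M" "n \<in> carrier N" "n' \<in> carrier N"
  shows "t m (n \<oplus>\<^bsub>N\<^esub> n') = t m n \<oplus>\<^bsub>T\<^esub> t m n'"
proof -
  have "frag_of (m, n \<oplus>\<^bsub>N\<^esub> n') - frag_of (m, n) - frag_of (m, n') \<in> tensor_rels K R M N"
    unfolding tensor_rels_def using assms by blast
  then have "H #>\<^bsub>F\<^esub> frag_of (m, n \<oplus>\<^bsub>N\<^esub> n') = H #>\<^bsub>F\<^esub> (frag_of (m, n) + frag_of (m, n'))"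
    by (intro coset_eqI gen_closed plus_closed) (simp_all add: assms diff_diff_add)
  then show ?thesis unfolding pure_def using assms by (simp only: add_tensor gen_closed)
qed

lemma pure_smult:
  assumes "k \<in> carrier K" "m \<in> carrier M" "n \<in> carrier N"
  shows "t (k \<odot>\<^bsub>M\<^esub> m) n = t m (k \<odot>\<^bsub>N\<^esub> n)"
  unfolding pure_def
proof (rule coset_eqI)
  show "frag_of (k \<odot>\<^bsub>M\<^esub> m, n) - frag_of (m, k \<odot>\<^bsub>N\<^esub> n) \<in> tensor_rels K R M N"
    unfolding tensor_rels_def using assms by blast
qed (rule gen_closed; simp add: assms M.M.smult_closed N.M.smult_closed)+

lemma pure_act:
  assumes "r \<in> carrier R" "m \<in> carrier M" "n \<in> carrier N"
  shows "t (ract M m r) n = t m (lact N r n)"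
  unfolding pure_def
proof (rule coset_eqI)
  show "frag_of (ract M m r, n) - frag_of (m, lact N r n) \<in> tensor_rels K R M N"
    unfolding tensor_rels_def using assms by blast
qed (rule gen_closed; simp add: assms M.ract_closed N.lact_closed)+

lemma pure_zero_l: "n \<in> carrier N \<Longrightarrow> t \<zero>\<^bsub>M\<^esub> n = \<zero>\<^bsub>T\<^esub>"
  by (rule additive_zero[OF bimodule_abelian_group[OF left] T.abelian_group_axioms])
    (auto simp: pure_closed pure_add_l)

lemma pure_zero_r: "m \<in> carrier M \<Longrightarrow> t m \<zero>\<^bsub>N\<^esub> = \<zero>\<^bsub>T\<^esub>"
  by (rule additive_zero[OF bimodule_abelian_group[OF right] T.abelian_group_axioms])
    (auto simp: pure_closed pure_add_r)

text \<open>
  Additive inverses need no case of their own, because \<open>-(m \<otimes> n) = (-m) \<otimes> n\<close>. The induction on the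
  free abelian group, which is phrased with subtraction, therefore carries \<open>c\<close> and \<open>-c\<close> along
  together.
\<close>

lemma tensor_induct [consumes 1, case_names zero pure add]:
  assumes x: "x \<in> carrier T" and zero: "Q \<zero>\<^bsub>T\<^esub>"
    and pure: "\<And>m n. \<lbrakk>m \<in> carrier M; n \<in> carrier N\<rbrakk> \<Longrightarrow> Q (t m n)"
    and add: "\<And>x y. \<lbrakk>x \<in> carrier T; y \<in> carrier T; Q x; Q y\<rbrakk> \<Longrightarrow> Q (x \<oplus>\<^bsub>T\<^esub> y)"
  shows "Q x"
proof -
  obtain c where c: "x = H #>\<^bsub>F\<^esub> c" "c \<in> carrier F" using x unfolding carrier_tensor by blast
  have cl: "H #>\<^bsub>F\<^esub> c \<in> carrier T" if "c \<in> carrier F" for c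
    using that unfolding carrier_tensor by blast
  have um: "- d \<in> carrier F" if "d \<in> carrier F" for d
    using F.inv_closed[OF that] that by simp
  have "Poly_Mapping.keys c \<subseteq> carrier M \<times> carrier N" using c by simp
  then have "Q (H #>\<^bsub>F\<^esub> c) \<and> Q (H #>\<^bsub>F\<^esub> (- c))"
  proof (induction c rule: free_Abelian_group_induct[consumes 1, case_names 1 2 3])
    case 1
    then show ?case using zero zero_tensor by simp
  next
    case (2 c d)
    then have k: "c \<in> carrier F" "d \<in> carrier F" "- c \<in> carrier F" "- d \<in> carrier F" using um by auto
    have "Q ((H #>\<^bsub>F\<^esub> c) \<oplus>\<^bsub>T\<^esub> (H #>\<^bsub>F\<^esub> (- d)))" "Q ((H #>\<^bsub>F\<^esub> (- c)) \<oplus>\<^bsub>T\<^esub> (H #>\<^bsub>F\<^esub> d))"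
      using 2 k by (auto intro!: add cl simp del: carrier_free_Abelian_group_iff)
    then show ?case using k by (simp add: add_tensor del: carrier_free_Abelian_group_iff)
  next
    case (3 a)
    then obtain m n where a: "a = (m, n)" "m \<in> carrier M" "n \<in> carrier N" by blast
    have m': "\<ominus>\<^bsub>M\<^esub> m \<in> carrier M" using a by simp
    have g: "frag_of (m, n) \<in> carrier F" using gen_closed a by blast
    have "t (\<ominus>\<^bsub>M\<^esub> m) n \<oplus>\<^bsub>T\<^esub> t m n = \<zero>\<^bsub>T\<^esub>"
      using a pure_add_l[of "\<ominus>\<^bsub>M\<^esub> m" m n] by (simp add: abelian_group.l_neg[OF bimodule_abelian_group[OF left]] pure_zero_l)
    moreover have "(H #>\<^bsub>F\<^esub> (- frag_of (m, n))) \<oplus>\<^bsub>T\<^esub> t m n = \<zero>\<^bsub>T\<^esub>"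
      unfolding pure_def using g um[OF g] by (simp add: add_tensor zero_tensor del: carrier_free_Abelian_group_iff)
    ultimately have "H #>\<^bsub>F\<^esub> (- frag_of (m, n)) = t (\<ominus>\<^bsub>M\<^esub> m) n"
      using cl[OF um[OF g]] pure_closed a m' by (metis T.add.right_cancel)
    then show ?case using pure a m' by (metis pure_def)
  qed
  then show ?thesis using c by simp
qed

lemma tensor_lift_additive:
  assumes X: "abelian_group X" and f: "balanced K R M N X f"
  shows "tensor_lift X f \<in> carrier T \<rightarrow> carrier X"
    and "\<lbrakk>x \<in> carrier T; y \<in> carrier T\<rbrakk>
      \<Longrightarrow> tensor_lift X f (x \<oplus>\<^bsub>T\<^esub> y) = tensor_lift X f x \<oplus>\<^bsub>X\<^esub> tensor_lift X f y"
    and "\<lbrakk>m \<in> carrier M; n \<in> carrier N\<rbrakk> \<Longrightarrow> tensor_lift X f (t m n) = f m n"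
proof -
  have h: "frag_eval X f \<in> hom F (add_monoid X)"
    by (rule frag_eval_hom[OF X]) (use f in \<open>auto simp: balanced_def\<close>)
  note l = tensor_lift_coset[OF left right X f]
  show "tensor_lift X f \<in> carrier T \<rightarrow> carrier X"
    using h unfolding carrier_tensor hom_def 
    by (auto simp: l Pi_def simp del: carrier_free_Abelian_group_iff)
  show "tensor_lift X f (x \<oplus>\<^bsub>T\<^esub> y) = tensor_lift X f x \<oplus>\<^bsub>X\<^esub> tensor_lift X f y"
    if "x \<in> carrier T" "y \<in> carrier T"
  proof -
    obtain c where "x = H #>\<^bsub>F\<^esub> c" "c \<in> carrier F"
      using \<open>x \<in> carrier T\<close> unfolding carrier_tensor by blast
    moreover obtain d where "y = H #>\<^bsub>F\<^esub> d" "d \<in> carrier F"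
      using \<open>y \<in> carrier T\<close> unfolding carrier_tensor by blast
    ultimately show ?thesis
      using h unfolding hom_def by (simp add: add_tensor l plus_closed del: carrier_free_Abelian_group_iff)
  qed
  show "\<lbrakk>m \<in> carrier M; n \<in> carrier N\<rbrakk> \<Longrightarrow> tensor_lift X f (t m n) = f m n"
    by (rule tensor_lift_pure[OF left right X f])
qed

text \<open>
  The actions of the scalars, of \<open>L\<close> and of \<open>S\<close> on the tensor product are themselves lifts of
  balanced maps, so additivity and the value on pure tensors come from the universal property.
\<close>

lemma tensor_actions:
  shows tensor_smult_closed: "\<lbrakk>k \<in> carrier K; x \<in> carrier T\<rbrakk> \<Longrightarrow> k \<odot>\<^bsub>T\<^esub> x \<in> carrier T"
    and tensor_smult_add: "\<lbrakk>k \<in> carrier K; x \<in> carrier T; y \<in> carrier T\<rbrakk>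
      \<Longrightarrow> k \<odot>\<^bsub>T\<^esub> (x \<oplus>\<^bsub>T\<^esub> y) = k \<odot>\<^bsub>T\<^esub> x \<oplus>\<^bsub>T\<^esub> k \<odot>\<^bsub>T\<^esub> y"
    and tensor_smult_pure: "\<lbrakk>k \<in> carrier K; m \<in> carrier M; n \<in> carrier N\<rbrakk>
      \<Longrightarrow> k \<odot>\<^bsub>T\<^esub> t m n = t (k \<odot>\<^bsub>M\<^esub> m) n"
    and tensor_lact_closed: "\<lbrakk>l \<in> carrier L; x \<in> carrier T\<rbrakk> \<Longrightarrow> lact T l x \<in> carrier T"
    and tensor_lact_add: "\<lbrakk>l \<in> carrier L; x \<in> carrier T; y \<in> carrier T\<rbrakk>
      \<Longrightarrow> lact T l (x \<oplus>\<^bsub>T\<^esub> y) = lact T l x \<oplus>\<^bsub>T\<^esub> lact T l y"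
    and tensor_lact_pure: "\<lbrakk>l \<in> carrier L; m \<in> carrier M; n \<in> carrier N\<rbrakk>
      \<Longrightarrow> lact T l (t m n) = t (lact M l m) n"
    and tensor_ract_closed: "\<lbrakk>s \<in> carrier S; x \<in> carrier T\<rbrakk> \<Longrightarrow> ract T x s \<in> carrier T"
    and tensor_ract_add: "\<lbrakk>s \<in> carrier S; x \<in> carrier T; y \<in> carrier T\<rbrakk>
      \<Longrightarrow> ract T (x \<oplus>\<^bsub>T\<^esub> y) s = ract T x s \<oplus>\<^bsub>T\<^esub> ract T y s"
    and tensor_ract_pure: "\<lbrakk>s \<in> carrier S; m \<in> carrier M; n \<in> carrier N\<rbrakk>
      \<Longrightarrow> ract T (t m n) s = t m (ract N n s)"
proof -
  have b: "balanced K R M N G f \<longleftrightarrow> balanced K R M N T f" for f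
    unfolding balanced_def tensor_group_simps ..
  note lift = tensor_lift_additive[OF abelian_group_tensor_schemes(2), unfolded b tensor_group_simps]
  have T: "smult T = (\<lambda>k. tensor_lift G (\<lambda>m n. t (k \<odot>\<^bsub>M\<^esub> m) n))"
    "lact T = (\<lambda>l. tensor_lift G (\<lambda>m n. t (lact M l m) n))"
    "ract T = (\<lambda>x s. tensor_lift G (\<lambda>m n. t m (ract N n s)) x)"
    by (simp_all add: tensor_def Let_def)
  have s: "balanced K R M N T (\<lambda>m n. t (k \<odot>\<^bsub>M\<^esub> m) n)" if k: "k \<in> carrier K" for k
  proof -
    have "t (k \<odot>\<^bsub>M\<^esub> (k' \<odot>\<^bsub>M\<^esub> m)) n = t (k \<odot>\<^bsub>M\<^esub> m) (k' \<odot>\<^bsub>N\<^esub> n)"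
      if "k' \<in> carrier K" "m \<in> carrier M" "n \<in> carrier N" for k' m n
      using that k M.M.smult_assoc1[of k k' m] M.M.smult_assoc1[of k' k m] cring.cring_simprules(14)[OF module.axioms(1)[OF bimodule_module[OF left]], of k k']
        pure_smult[of k' "k \<odot>\<^bsub>M\<^esub> m" n] M.M.smult_closed by simp
    then show ?thesis
      using k M.M.smult_closed unfolding balanced_def
      by (simp add: pure_closed M.M.smult_r_distr pure_add_l pure_add_r M.ract_closed
          M.ract_smult_l[symmetric] pure_act)
  qed
  have l: "balanced K R M N T (\<lambda>m n. t (lact M l m) n)" if "l \<in> carrier L" for l
    using that unfolding balanced_def
    by (simp add: pure_closed M.lact_closed M.lact_add_r pure_add_l pure_add_r M.lact_smult_r
        pure_smult M.lact_ract[symmetric] pure_act)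
  have r: "balanced K R M N T (\<lambda>m n. t m (ract N n s))" if "s \<in> carrier S" for s
    using that unfolding balanced_def
    by (simp add: pure_closed N.ract_closed N.ract_add_l pure_add_l pure_add_r N.ract_smult_l
        pure_smult N.lact_ract pure_act)
  show "\<lbrakk>k \<in> carrier K; x \<in> carrier T\<rbrakk> \<Longrightarrow> k \<odot>\<^bsub>T\<^esub> x \<in> carrier T"
    and "\<lbrakk>k \<in> carrier K; x \<in> carrier T; y \<in> carrier T\<rbrakk>
      \<Longrightarrow> k \<odot>\<^bsub>T\<^esub> (x \<oplus>\<^bsub>T\<^esub> y) = k \<odot>\<^bsub>T\<^esub> x \<oplus>\<^bsub>T\<^esub> k \<odot>\<^bsub>T\<^esub> y"
    and "\<lbrakk>k \<in> carrier K; m \<in> carrier M; n \<in> carrier N\<rbrakk> \<Longrightarrow> k \<odot>\<^bsub>T\<^esub> t m n = t (k \<odot>\<^bsub>M\<^esub> m) n"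
    by (simp_all add: T lift(2,3)[OF s] funcset_mem[OF lift(1)[OF s]])
  show "\<lbrakk>l \<in> carrier L; x \<in> carrier T\<rbrakk> \<Longrightarrow> lact T l x \<in> carrier T"
    and "\<lbrakk>l \<in> carrier L; x \<in> carrier T; y \<in> carrier T\<rbrakk>
      \<Longrightarrow> lact T l (x \<oplus>\<^bsub>T\<^esub> y) = lact T l x \<oplus>\<^bsub>T\<^esub> lact T l y"
    and "\<lbrakk>l \<in> carrier L; m \<in> carrier M; n \<in> carrier N\<rbrakk> \<Longrightarrow> lact T l (t m n) = t (lact M l m) n"
    by (simp_all add: T lift(2,3)[OF l] funcset_mem[OF lift(1)[OF l]])
  show "\<lbrakk>s \<in> carrier S; x \<in> carrier T\<rbrakk> \<Longrightarrow> ract T x s \<in> carrier T"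
    and "\<lbrakk>s \<in> carrier S; x \<in> carrier T; y \<in> carrier T\<rbrakk>
      \<Longrightarrow> ract T (x \<oplus>\<^bsub>T\<^esub> y) s = ract T x s \<oplus>\<^bsub>T\<^esub> ract T y s"
    and "\<lbrakk>s \<in> carrier S; m \<in> carrier M; n \<in> carrier N\<rbrakk> \<Longrightarrow> ract T (t m n) s = t m (ract N n s)"
    by (simp_all add: T lift(2,3)[OF r] funcset_mem[OF lift(1)[OF r]])
qed

text \<open>
  Linearity of an additive map out of a tensor product can be tested on pure tensors. The map is an
  arbitrary additive one so that the lemma covers lifts into an algebra that are regarded as maps
  into its regular bimodule, and composites of lifts.
\<close>

lemma tensor_bimod_homI:
  assumes X: "bimodule K L S X" and h: "h \<in> carrier T \<rightarrow> carrier X"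
    and add: "\<And>x y. \<lbrakk>x \<in> carrier T; y \<in> carrier T\<rbrakk> \<Longrightarrow> h (x \<oplus>\<^bsub>T\<^esub> y) = h x \<oplus>\<^bsub>X\<^esub> h y"
    and smult: "\<And>k m n. \<lbrakk>k \<in> carrier K; m \<in> carrier M; n \<in> carrier N\<rbrakk>
      \<Longrightarrow> h (t (k \<odot>\<^bsub>M\<^esub> m) n) = k \<odot>\<^bsub>X\<^esub> h (t m n)"
    and lact: "\<And>l m n. \<lbrakk>l \<in> carrier L; m \<in> carrier M; n \<in> carrier N\<rbrakk>
      \<Longrightarrow> h (t (lact M l m) n) = lact X l (h (t m n))"
    and ract: "\<And>s m n. \<lbrakk>s \<in> carrier S; m \<in> carrier M; n \<in> carrier N\<rbrakk>
      \<Longrightarrow> h (t m (ract N n s)) = ract X (h (t m n)) s"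
  shows "h \<in> bimod_hom K L S T X"
proof -
  interpret X: bimodule K L S X by (rule X)
  have eq: "h (f x) = g (h x)"
    if f: "f \<in> carrier T \<rightarrow> carrier T" "\<And>x y. \<lbrakk>x \<in> carrier T; y \<in> carrier T\<rbrakk> \<Longrightarrow> f (x \<oplus>\<^bsub>T\<^esub> y) = f x \<oplus>\<^bsub>T\<^esub> f y"
      and g: "g \<in> carrier X \<rightarrow> carrier X" "\<And>x y. \<lbrakk>x \<in> carrier X; y \<in> carrier X\<rbrakk> \<Longrightarrow> g (x \<oplus>\<^bsub>X\<^esub> y) = g x \<oplus>\<^bsub>X\<^esub> g y"
      and p: "\<And>m n. \<lbrakk>m \<in> carrier M; n \<in> carrier N\<rbrakk> \<Longrightarrow> h (f (t m n)) = g (h (t m n))"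
      and x: "x \<in> carrier T" for f g x
    using x
  proof (induction rule: tensor_induct)
    case zero
    have "h \<zero>\<^bsub>T\<^esub> = \<zero>\<^bsub>X\<^esub>" "f \<zero>\<^bsub>T\<^esub> = \<zero>\<^bsub>T\<^esub>" "g \<zero>\<^bsub>X\<^esub> = \<zero>\<^bsub>X\<^esub>"
      by (rule additive_zero; fact T.abelian_group_axioms bimodule_abelian_group[OF X] h add f g)+
    then show ?case by simp
  next
    case (pure m n)
    then show ?case by (rule p)
  next
    case (add x y)
    then show ?case using f g h assms(3) by (simp add: Pi_def)
  qed
  show ?thesis
    unfolding bimod_hom_def
    using h add
      eq[of "\<lambda>x. k \<odot>\<^bsub>T\<^esub> x" "\<lambda>x. k \<odot>\<^bsub>X\<^esub> x" for k] eq[of "lact T l" "lact X l" for l]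
      eq[of "\<lambda>x. ract T x s" "\<lambda>x. ract X x s" for s]
    by (simp add: tensor_actions smult lact ract X.M.smult_closed X.M.smult_r_distr
        X.lact_closed X.lact_add_r X.ract_closed X.ract_add_l)
qed

end

section \<open>Local units and firmness\<close>

definition local_units :: "('k, 'r) module \<Rightarrow> bool" where
  "local_units R \<longleftrightarrow> (\<forall>X. finite X \<and> X \<subseteq> carrier R \<longrightarrow>
     (\<exists>u\<in>carrier R. \<forall>x\<in>X. u \<otimes>\<^bsub>R\<^esub> x = x \<and> x \<otimes>\<^bsub>R\<^esub> u = x))"

lemma regular_simps [simp]:
  "carrier (regular R) = carrier R" "add (regular R) = add R" "zero (regular R) = zero R"
  "smult (regular R) = smult R" "lact (regular R) = mult R" "ract (regular R) = mult R"
  by (simp_all add: regular_def)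

lemma bimodule_regular:
  assumes "k_algebra K R"
  shows "bimodule K R R (regular R)"
proof -
  interpret k_algebra K R by fact
  have "abelian_group (regular R)"
    by (rule abelian_groupI) (auto simp: M.a_ac intro: M.add.l_inv_ex)
  then have "module K (regular R)"
    by (intro moduleI R.is_cring) (auto simp: smult_l_distr smult_r_distr smult_assoc1)
  then show ?thesis
    by (intro bimodule.intro left_module.intro right_module.intro left_module_axioms.intro
        right_module_axioms.intro bimodule_axioms.intro assms)
      (auto simp: mult_closed mult_assoc mult_l_distr mult_r_distr smult_mult_l smult_mult_r)
qed

text \<open>
  Surjectivity is clear from the hypothesis on \<open>M\<close>. For injectivity every tensor \<open>x\<close> is rewritten as
  the pure tensor \<open>h(x) \<otimes> u\<close>, where \<open>u\<close> is any right unit for the finitely many elements of \<open>R\<close>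
  occurring in a representative of \<open>x\<close>: indeed \<open>m \<otimes> r = m \<otimes> r u = m r \<otimes> u\<close>. Two tensors with the
  same image can be given the same \<open>u\<close>.
\<close>

lemma right_action_iso:
  assumes M: "bimodule K L R M" and R: "local_units R"
    and M1: "\<And>m. m \<in> carrier M \<Longrightarrow> \<exists>u\<in>carrier R. ract M m u = m"
    and h: "h \<in> carrier (tensor K R M (regular R)) \<rightarrow> carrier M"
    and add: "\<And>x y. \<lbrakk>x \<in> carrier (tensor K R M (regular R)); y \<in> carrier (tensor K R M (regular R))\<rbrakk>
      \<Longrightarrow> h (x \<oplus>\<^bsub>tensor K R M (regular R)\<^esub> y) = h x \<oplus>\<^bsub>M\<^esub> h y"
    and pure: "\<And>m r. \<lbrakk>m \<in> carrier M; r \<in> carrier R\<rbrakk>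
      \<Longrightarrow> h (pure K R M (regular R) m r) = ract M m r"
  shows "h \<in> bimod_iso K L R (tensor K R M (regular R)) M"
proof -
  interpret M: bimodule K L R M by (rule M)
  have Ra: "k_algebra K R" by (rule M.R.k_algebra_axioms)
  interpret P: bimodule_pair K L R R M "regular R"
    by (intro bimodule_pair.intro M bimodule_regular Ra)
  let ?T = "tensor K R M (regular R)" and ?t = "pure K R M (regular R)"
  have smK: "k \<odot>\<^bsub>M\<^esub> m \<in> carrier M" if "k \<in> carrier K" "m \<in> carrier M" for k m
    using module.smult_closed[OF bimodule_module[OF M]] that .
  have "h \<in> bimod_hom K L R ?T M"
    by (rule P.tensor_bimod_homI[OF M h add])
      (simp_all add: pure smK M.ract_closed M.lact_closed k_algebra.mult_closed[OF Ra] M.ract_smult_l M.ract_assoc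
        M.lact_ract)
  moreover have collapse: "\<exists>X. finite X \<and> X \<subseteq> carrier R \<and>
      (\<forall>u\<in>carrier R. (\<forall>x\<in>X. x \<otimes>\<^bsub>R\<^esub> u = x) \<longrightarrow> z = ?t (h z) u)"
    if "z \<in> carrier ?T" for z
    using that
  proof (induction rule: P.tensor_induct)
    case zero
    have "h \<zero>\<^bsub>?T\<^esub> = \<zero>\<^bsub>M\<^esub>"
      by (rule additive_zero[OF P.abelian_group_tensor_schemes(1) bimodule_abelian_group[OF M] h add])
    then show ?case by (auto intro!: exI[of _ "{}"] simp: P.pure_zero_l)
  next
    case (pure m r)
    have "?t m r = ?t (ract M m r) u" if "u \<in> carrier R" "r \<otimes>\<^bsub>R\<^esub> u = r" for u
      using P.pure_act[of r m u] pure that by simp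
    then show ?case using pure by (auto intro!: exI[of _ "{r}"] simp: assms(6))
  next
    case (add x y)
    then obtain X Y where X: "finite X" "X \<subseteq> carrier R"
        "\<And>u. \<lbrakk>u \<in> carrier R; \<forall>x\<in>X. x \<otimes>\<^bsub>R\<^esub> u = x\<rbrakk> \<Longrightarrow> x = ?t (h x) u"
      and Y: "finite Y" "Y \<subseteq> carrier R"
        "\<And>u. \<lbrakk>u \<in> carrier R; \<forall>x\<in>Y. x \<otimes>\<^bsub>R\<^esub> u = x\<rbrakk> \<Longrightarrow> y = ?t (h y) u" by metis
    have hxy: "h x \<in> carrier M" "h y \<in> carrier M" using h add by auto
    have "x \<oplus>\<^bsub>?T\<^esub> y = ?t (h (x \<oplus>\<^bsub>?T\<^esub> y)) u"
      if u: "u \<in> carrier R" "\<forall>x\<in>X \<union> Y. x \<otimes>\<^bsub>R\<^esub> u = x" for u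
    proof -
      have "x = ?t (h x) u" "y = ?t (h y) u" using X(3) Y(3) u by auto
      then show ?thesis
        using P.pure_add_l[OF hxy, of u] u(1) assms(5)[OF add(1,2)] by simp
    qed
    with X Y show ?case by (intro exI[of _ "X \<union> Y"]) auto
  qed
  have "inj_on h (carrier ?T)"
  proof
    fix x y assume xy: "x \<in> carrier ?T" "y \<in> carrier ?T" "h x = h y"
    obtain X Y where X: "finite X" "X \<subseteq> carrier R"
        "\<And>u. \<lbrakk>u \<in> carrier R; \<forall>x\<in>X. x \<otimes>\<^bsub>R\<^esub> u = x\<rbrakk> \<Longrightarrow> x = ?t (h x) u"
      and Y: "finite Y" "Y \<subseteq> carrier R"
        "\<And>u. \<lbrakk>u \<in> carrier R; \<forall>x\<in>Y. x \<otimes>\<^bsub>R\<^esub> u = x\<rbrakk> \<Longrightarrow> y = ?t (h y) u"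
      using collapse[OF xy(1)] collapse[OF xy(2)] by metis
    have "finite (X \<union> Y) \<and> X \<union> Y \<subseteq> carrier R" using X Y by simp
    from R[unfolded local_units_def, rule_format, OF this] obtain u where
      "u \<in> carrier R" "\<forall>x\<in>X \<union> Y. x \<otimes>\<^bsub>R\<^esub> u = x" by blast
    then have "x = ?t (h x) u" "y = ?t (h y) u" using X(3) Y(3) by auto
    with xy(3) show "x = y" by simp
  qed
  moreover have "h ` carrier ?T = carrier M"
  proof
    show "carrier M \<subseteq> h ` carrier ?T"
    proof
      fix m assume m: "m \<in> carrier M"
      then obtain u where "u \<in> carrier R" "ract M m u = m" using M1 by blast
      then have "m = h (?t m u)" "?t m u \<in> carrier ?T"
        using m pure P.pure_closed by auto
      then show "m \<in> h ` carrier ?T" by blast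
    qed
  qed (use h in auto)
  ultimately show ?thesis by (simp add: bimod_iso_def bij_betw_def)
qed

text \<open>
  The mirror image: here \<open>l \<otimes> m = u l \<otimes> m = u \<otimes> l m\<close>.
\<close>

lemma left_action_iso:
  assumes M: "bimodule K L R M" and L: "local_units L"
    and M1: "\<And>m. m \<in> carrier M \<Longrightarrow> \<exists>u\<in>carrier L. lact M u m = m"
    and h: "h \<in> carrier (tensor K L (regular L) M) \<rightarrow> carrier M"
    and add: "\<And>x y. \<lbrakk>x \<in> carrier (tensor K L (regular L) M); y \<in> carrier (tensor K L (regular L) M)\<rbrakk>
      \<Longrightarrow> h (x \<oplus>\<^bsub>tensor K L (regular L) M\<^esub> y) = h x \<oplus>\<^bsub>M\<^esub> h y"
    and pure: "\<And>l m. \<lbrakk>l \<in> carrier L; m \<in> carrier M\<rbrakk>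
      \<Longrightarrow> h (pure K L (regular L) M l m) = lact M l m"
  shows "h \<in> bimod_iso K L R (tensor K L (regular L) M) M"
proof -
  interpret M: bimodule K L R M by (rule M)
  have La: "k_algebra K L" by (rule M.L.k_algebra_axioms)
  interpret P: bimodule_pair K L L R "regular L" M
    by (intro bimodule_pair.intro M bimodule_regular La)
  let ?T = "tensor K L (regular L) M" and ?t = "pure K L (regular L) M"
  have smK: "k \<odot>\<^bsub>L\<^esub> l \<in> carrier L" if "k \<in> carrier K" "l \<in> carrier L" for k l
    using module.smult_closed[OF k_algebra.axioms(1)[OF La]] that .
  have "h \<in> bimod_hom K L R ?T M"
    by (rule P.tensor_bimod_homI[OF M h add])
      (simp_all add: pure smK M.ract_closed M.lact_closed k_algebra.mult_closed[OF La] M.lact_smult_l M.lact_assoc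
        M.lact_ract)
  moreover have collapse: "\<exists>X. finite X \<and> X \<subseteq> carrier L \<and>
      (\<forall>u\<in>carrier L. (\<forall>x\<in>X. u \<otimes>\<^bsub>L\<^esub> x = x) \<longrightarrow> z = ?t u (h z))"
    if "z \<in> carrier ?T" for z
    using that
  proof (induction rule: P.tensor_induct)
    case zero
    have "h \<zero>\<^bsub>?T\<^esub> = \<zero>\<^bsub>M\<^esub>"
      by (rule additive_zero[OF P.abelian_group_tensor_schemes(1) bimodule_abelian_group[OF M] h add])
    then show ?case by (auto intro!: exI[of _ "{}"] simp: P.pure_zero_r)
  next
    case (pure l m)
    have "?t l m = ?t u (lact M l m)" if "u \<in> carrier L" "u \<otimes>\<^bsub>L\<^esub> l = l" for u
      using P.pure_act[of l u m] pure that by simp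
    then show ?case using pure by (auto intro!: exI[of _ "{l}"] simp: assms(6))
  next
    case (add x y)
    then obtain X Y where X: "finite X" "X \<subseteq> carrier L"
        "\<And>u. \<lbrakk>u \<in> carrier L; \<forall>x\<in>X. u \<otimes>\<^bsub>L\<^esub> x = x\<rbrakk> \<Longrightarrow> x = ?t u (h x)"
      and Y: "finite Y" "Y \<subseteq> carrier L"
        "\<And>u. \<lbrakk>u \<in> carrier L; \<forall>x\<in>Y. u \<otimes>\<^bsub>L\<^esub> x = x\<rbrakk> \<Longrightarrow> y = ?t u (h y)" by metis
    have hxy: "h x \<in> carrier M" "h y \<in> carrier M" using h add by auto
    have "x \<oplus>\<^bsub>?T\<^esub> y = ?t u (h (x \<oplus>\<^bsub>?T\<^esub> y))"
      if u: "u \<in> carrier L" "\<forall>x\<in>X \<union> Y. u \<otimes>\<^bsub>L\<^esub> x = x" for u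
    proof -
      have "x = ?t u (h x)" "y = ?t u (h y)" using X(3) Y(3) u by auto
      then show ?thesis
        using P.pure_add_r[OF _ hxy, of u] u(1) assms(5)[OF add(1,2)] by simp
    qed
    with X Y show ?case by (intro exI[of _ "X \<union> Y"]) auto
  qed
  have "inj_on h (carrier ?T)"
  proof
    fix x y assume xy: "x \<in> carrier ?T" "y \<in> carrier ?T" "h x = h y"
    obtain X Y where X: "finite X" "X \<subseteq> carrier L"
        "\<And>u. \<lbrakk>u \<in> carrier L; \<forall>x\<in>X. u \<otimes>\<^bsub>L\<^esub> x = x\<rbrakk> \<Longrightarrow> x = ?t u (h x)"
      and Y: "finite Y" "Y \<subseteq> carrier L"
        "\<And>u. \<lbrakk>u \<in> carrier L; \<forall>x\<in>Y. u \<otimes>\<^bsub>L\<^esub> x = x\<rbrakk> \<Longrightarrow> y = ?t u (h y)"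
      using collapse[OF xy(1)] collapse[OF xy(2)] by metis
    have "finite (X \<union> Y) \<and> X \<union> Y \<subseteq> carrier L" using X Y by simp
    from L[unfolded local_units_def, rule_format, OF this] obtain u where
      "u \<in> carrier L" "\<forall>x\<in>X \<union> Y. u \<otimes>\<^bsub>L\<^esub> x = x" by blast
    then have "x = ?t u (h x)" "y = ?t u (h y)" using X(3) Y(3) by auto
    with xy(3) show "x = y" by simp
  qed
  moreover have "h ` carrier ?T = carrier M"
  proof
    show "carrier M \<subseteq> h ` carrier ?T"
    proof
      fix m assume m: "m \<in> carrier M"
      then obtain u where "u \<in> carrier L" "lact M u m = m" using M1 by blast
      then have "m = h (?t u m)" "?t u m \<in> carrier ?T"
        using m pure P.pure_closed by auto
      then show "m \<in> h ` carrier ?T" by blast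
    qed
  qed (use h in auto)
  ultimately show ?thesis by (simp add: bimod_iso_def bij_betw_def)
qed

lemma balanced_ract:
  assumes "bimodule K L R M"
  shows "balanced K R M (regular R) M (ract M)"
proof -
  interpret M: bimodule K L R M by fact
  show ?thesis
    unfolding balanced_def
    by (simp add: M.ract_closed M.ract_add_l M.ract_add_r M.ract_smult_l M.ract_smult_r M.ract_assoc)
qed

lemma balanced_lact:
  assumes "bimodule K L R M"
  shows "balanced K L (regular L) M M (lact M)"
proof -
  interpret M: bimodule K L R M by fact
  show ?thesis
    unfolding balanced_def
    by (simp add: M.lact_closed M.lact_add_l M.lact_add_r M.lact_smult_l M.lact_smult_r M.lact_assoc)
qed

theorem firm_bimoduleI:
  assumes M: "bimodule K L R M" and "local_units L" "local_units R"
    and "\<And>m. m \<in> carrier M \<Longrightarrow> \<exists>u\<in>carrier L. lact M u m = m"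
    and "\<And>m. m \<in> carrier M \<Longrightarrow> \<exists>u\<in>carrier R. ract M m u = m"
  shows "firm_bimodule K L R M"
proof -
  interpret M: bimodule K L R M by (rule M)
  have La: "k_algebra K L" and Ra: "k_algebra K R"
    by (rule M.L.k_algebra_axioms M.R.k_algebra_axioms)+
  interpret l: bimodule_pair K L L R "regular L" M by (intro bimodule_pair.intro M bimodule_regular La)
  interpret r: bimodule_pair K L R R M "regular R" by (intro bimodule_pair.intro M bimodule_regular Ra)
  note l = l.tensor_lift_additive[OF bimodule_abelian_group[OF M] balanced_lact[OF M], simplified]
  note r = r.tensor_lift_additive[OF bimodule_abelian_group[OF M] balanced_ract[OF M], simplified]
  show ?thesis
    unfolding firm_bimodule_def
    using left_action_iso[OF M assms(2,4) l] right_action_iso[OF M assms(3,5) r] M by blast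
qed

theorem firm_algebraI:
  assumes R: "k_algebra K R" and u: "local_units R"
  shows "firm_algebra K R"
proof -
  note M = bimodule_regular[OF R]
  interpret R: k_algebra K R by (rule R)
  interpret r: bimodule_pair K R R R "regular R" "regular R" by (intro bimodule_pair.intro M)
  have ab: "abelian_group R" by (rule module.axioms(2)[OF k_algebra.axioms(1)[OF R]])
  have b: "balanced K R (regular R) (regular R) R (mult R)"
    using balanced_ract[OF M] by (simp add: balanced_def)
  note r = r.tensor_lift_additive[OF ab b, simplified]
  have "\<exists>v\<in>carrier R. x \<otimes>\<^bsub>R\<^esub> v = x" if "x \<in> carrier R" for x
    using u[unfolded local_units_def, rule_format, of "{x}"] that by auto
  then have "tensor_lift R (mult R) \<in> bimod_iso K R R (tensor K R (regular R) (regular R)) (regular R)"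
    by (intro right_action_iso[OF M u]) (use r in simp_all)
  then show ?thesis by (simp add: firm_algebra_def R)
qed

lemma local_units_unital:
  assumes "ring R"
  shows "local_units R"
proof -
  interpret ring R by fact
  show ?thesis unfolding local_units_def by (intro allI impI bexI[of _ "\<one>\<^bsub>R\<^esub>"]) auto
qed

lemma (in idempotent_local_units) local_units_B: "local_units B"
  unfolding local_units_def using e_local e_closed by blast

text \<open>
  Every element of a firm module is a sum of products \<open>m a\<close>, and on those the unit acts trivially.
\<close>

lemma firm_right_unital:
  assumes P: "firm_bimodule K B A P" and A: "ring A" and p: "p \<in> carrier P"
  shows "ract P p \<one>\<^bsub>A\<^esub> = p"
proof -
  have M: "bimodule K B A P" using P by (simp add: firm_bimodule_def)
  interpret P: bimodule K B A P by (rule M)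
  interpret A: ring A by (rule A)
  have Aa: "k_algebra K A" by (rule P.R.k_algebra_axioms)
  interpret r: bimodule_pair K B A A P "regular A" by (intro bimodule_pair.intro M bimodule_regular Aa)
  note r = r.tensor_lift_additive[OF bimodule_abelian_group[OF M] balanced_ract[OF M], simplified]
  let ?h = "tensor_lift P (ract P)"
  have ab: "abelian_group P" by (rule bimodule_abelian_group[OF M])
  have "ract P (?h z) \<one>\<^bsub>A\<^esub> = ?h z" if "z \<in> carrier (tensor K A P (regular A))" for z
    using that
  proof (induction rule: r.tensor_induct)
    case zero
    show ?case
      using additive_zero[OF r.abelian_group_tensor_schemes(1) ab r(1,2)]
        P.ract_null_l[OF A.one_closed] by simp
  next
    case (pure m n)
    then show ?case by (simp add: r(3) P.ract_assoc[symmetric])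
  next
    case (add x y)
    then show ?case using r(1) by (simp add: r(2) P.ract_add_l Pi_def)
  qed
  moreover have "p \<in> ?h ` carrier (tensor K A P (regular A))"
    using P p by (simp add: firm_bimodule_def bimod_iso_def bij_betw_def)
  ultimately show ?thesis by auto
qed

section \<open>Dual modules\<close>

lemma bimodule_algebras:
  assumes "bimodule K L R M"
  shows "k_algebra K L" "k_algebra K R"
  using assms by (simp_all add: bimodule_def left_module_def right_module_def)

text \<open>
  Closure under negation comes for free, as \<open>-x = (-1) x\<close>.
\<close>

lemma sub_bimodule:
  assumes M: "bimodule K L R M" and C: "C \<subseteq> carrier M" and zero: "\<zero>\<^bsub>M\<^esub> \<in> C"
    and add: "\<And>x y. \<lbrakk>x \<in> C; y \<in> C\<rbrakk> \<Longrightarrow> x \<oplus>\<^bsub>M\<^esub> y \<in> C"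
    and smult: "\<And>k x. \<lbrakk>k \<in> carrier K; x \<in> C\<rbrakk> \<Longrightarrow> k \<odot>\<^bsub>M\<^esub> x \<in> C"
    and lact: "\<And>l x. \<lbrakk>l \<in> carrier L; x \<in> C\<rbrakk> \<Longrightarrow> lact M l x \<in> C"
    and ract: "\<And>r x. \<lbrakk>r \<in> carrier R; x \<in> C\<rbrakk> \<Longrightarrow> ract M x r \<in> C"
  shows "bimodule K L R (M\<lparr>carrier := C\<rparr>)"
proof -
  interpret m: module K M by (rule bimodule_module[OF M])
  note Lm = bimodule.axioms(1)[OF M] and Rm = bimodule.axioms(2)[OF M]
  note La = bimodule_algebras(1)[OF M] and Ra = bimodule_algebras(2)[OF M]
  note laws = left_module.lact_add_l[OF Lm] left_module.lact_add_r[OF Lm] left_module.lact_assoc[OF Lm]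
    left_module.lact_smult_l[OF Lm] left_module.lact_smult_r[OF Lm]
    right_module.ract_add_l[OF Rm] right_module.ract_add_r[OF Rm] right_module.ract_assoc[OF Rm]
    right_module.ract_smult_l[OF Rm] right_module.ract_smult_r[OF Rm] bimodule.lact_ract[OF M]
  have c: "x \<in> carrier M" if "x \<in> C" for x using C that by blast
  have "abelian_group (M\<lparr>carrier := C\<rparr>)"
  proof (rule abelian_groupI)
    fix x assume "x \<in> carrier (M\<lparr>carrier := C\<rparr>)"
    then have x: "x \<in> C" by simp
    have "(\<ominus>\<^bsub>K\<^esub> \<one>\<^bsub>K\<^esub>) \<odot>\<^bsub>M\<^esub> x \<oplus>\<^bsub>M\<^esub> x = \<zero>\<^bsub>M\<^esub>"
      using c[OF x] by (simp add: m.smult_l_minus m.l_neg)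
    then show "\<exists>y\<in>carrier (M\<lparr>carrier := C\<rparr>). y \<oplus>\<^bsub>M\<lparr>carrier := C\<rparr>\<^esub> x = \<zero>\<^bsub>M\<lparr>carrier := C\<rparr>\<^esub>"
      using smult[OF _ x] by auto
  qed (simp_all add: zero add m.a_ac c)
  then have "module K (M\<lparr>carrier := C\<rparr>)"
    by (intro moduleI m.R.is_cring)
      (simp_all add: smult m.smult_l_distr m.smult_r_distr m.smult_assoc1 c)
  then show ?thesis
    by (intro bimodule.intro left_module.intro right_module.intro left_module_axioms.intro
        right_module_axioms.intro bimodule_axioms.intro La Ra)
      (simp_all add: lact ract laws c)
qed

locale right_unital_bimodule =
  fixes K :: "'k ring" and B :: "('k, 'b) module" and A :: "('k, 'a) module"
    and P :: "('k, 'b, 'p, 'a) bimod"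
  assumes bimodule_P: "bimodule K B A P" and ring_A: "ring A"
    and ract_one: "p \<in> carrier P \<Longrightarrow> ract P p \<one>\<^bsub>A\<^esub> = p"
begin

lemma algebra_A: "k_algebra K A" and left_algebra: "k_algebra K B"
  by (rule bimodule_algebras[OF bimodule_P])+

interpretation A: ring A by (rule ring_A)
interpretation kA: k_algebra K A by (rule algebra_A)
interpretation kB: k_algebra K B by (rule left_algebra)
interpretation Pm: module K P by (rule bimodule_module[OF bimodule_P])
interpretation P: bimodule K B A P by (rule bimodule_P)

lemma abelian_P: "abelian_group P" by (rule bimodule_abelian_group[OF bimodule_P])

abbreviation "D \<equiv> dual A P"

lemma dual_iff: "\<phi> \<in> carrier D \<longleftrightarrow> \<phi> \<in> extensional (carrier P) \<and> (\<forall>p\<in>carrier P. \<phi> p \<in> carrier A) \<and>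
    (\<forall>p\<in>carrier P. \<forall>q\<in>carrier P. \<phi> (p \<oplus>\<^bsub>P\<^esub> q) = \<phi> p \<oplus>\<^bsub>A\<^esub> \<phi> q) \<and>
    (\<forall>p\<in>carrier P. \<forall>a\<in>carrier A. \<phi> (ract P p a) = \<phi> p \<otimes>\<^bsub>A\<^esub> a)"
  by (auto simp: dual_def right_hom_def)

lemma dual_closed: "\<lbrakk>\<phi> \<in> carrier D; p \<in> carrier P\<rbrakk> \<Longrightarrow> \<phi> p \<in> carrier A"
  and dual_add: "\<lbrakk>\<phi> \<in> carrier D; p \<in> carrier P; q \<in> carrier P\<rbrakk> \<Longrightarrow> \<phi> (p \<oplus>\<^bsub>P\<^esub> q) = \<phi> p \<oplus>\<^bsub>A\<^esub> \<phi> q"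
  and dual_ract: "\<lbrakk>\<phi> \<in> carrier D; p \<in> carrier P; a \<in> carrier A\<rbrakk> \<Longrightarrow> \<phi> (ract P p a) = \<phi> p \<otimes>\<^bsub>A\<^esub> a"
  by (simp_all add: dual_iff)

text \<open>
  The elements of the dual are only assumed \<open>A\<close>-linear; \<open>K\<close>-linearity follows from
  \<open>k p = p (k 1)\<close>. It is what makes the right action of \<open>B\<close> on the dual \<open>K\<close>-bilinear, and
  evaluation \<open>K\<close>-balanced.
\<close>

lemma dual_smult:
  assumes "\<phi> \<in> carrier D" "k \<in> carrier K" "p \<in> carrier P"
  shows "\<phi> (k \<odot>\<^bsub>P\<^esub> p) = k \<odot>\<^bsub>A\<^esub> \<phi> p"
proof -
  have "k \<odot>\<^bsub>P\<^esub> p = ract P p (k \<odot>\<^bsub>A\<^esub> \<one>\<^bsub>A\<^esub>)"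
    using assms P.ract_smult_r[of k "\<one>\<^bsub>A\<^esub>" p] by (simp add: ract_one)
  then show ?thesis
    using assms kA.smult_closed kA.smult_mult_r[of k "\<phi> p" "\<one>\<^bsub>A\<^esub>"]
    by (simp add: dual_ract dual_closed)
qed

lemma dual_eqI:
  "\<lbrakk>\<phi> \<in> carrier D; \<psi> \<in> carrier D; \<And>p. p \<in> carrier P \<Longrightarrow> \<phi> p = \<psi> p\<rbrakk> \<Longrightarrow> \<phi> = \<psi>"
  unfolding dual_iff by (blast intro: extensionalityI)

lemma dual_apply:
  assumes "p \<in> carrier P"
  shows "\<zero>\<^bsub>D\<^esub> p = \<zero>\<^bsub>A\<^esub>" "(\<phi> \<oplus>\<^bsub>D\<^esub> \<psi>) p = \<phi> p \<oplus>\<^bsub>A\<^esub> \<psi> p" "(k \<odot>\<^bsub>D\<^esub> \<phi>) p = k \<odot>\<^bsub>A\<^esub> \<phi> p"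
    "lact D a \<phi> p = a \<otimes>\<^bsub>A\<^esub> \<phi> p" "ract D \<phi> b p = \<phi> (lact P b p)"
  using assms by (simp_all add: dual_def)

lemma dual_ops_closed:
  shows "\<zero>\<^bsub>D\<^esub> \<in> carrier D"
    and "\<lbrakk>\<phi> \<in> carrier D; \<psi> \<in> carrier D\<rbrakk> \<Longrightarrow> \<phi> \<oplus>\<^bsub>D\<^esub> \<psi> \<in> carrier D"
    and "\<lbrakk>k \<in> carrier K; \<phi> \<in> carrier D\<rbrakk> \<Longrightarrow> k \<odot>\<^bsub>D\<^esub> \<phi> \<in> carrier D"
    and "\<lbrakk>a \<in> carrier A; \<phi> \<in> carrier D\<rbrakk> \<Longrightarrow> lact D a \<phi> \<in> carrier D"
    and "\<lbrakk>b \<in> carrier B; \<phi> \<in> carrier D\<rbrakk> \<Longrightarrow> ract D \<phi> b \<in> carrier D"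
proof -
  have ext: "\<zero>\<^bsub>D\<^esub> \<in> extensional (carrier P)" "\<phi> \<oplus>\<^bsub>D\<^esub> \<psi> \<in> extensional (carrier P)"
    "k \<odot>\<^bsub>D\<^esub> \<phi> \<in> extensional (carrier P)" "lact D a \<phi> \<in> extensional (carrier P)"
    "ract D \<phi> b \<in> extensional (carrier P)" for \<phi> \<psi> k a b
    by (simp_all add: dual_def)
  show "\<zero>\<^bsub>D\<^esub> \<in> carrier D"
    by (simp add: dual_iff ext dual_apply P.ract_closed Pm.a_closed)
  show "\<lbrakk>\<phi> \<in> carrier D; \<psi> \<in> carrier D\<rbrakk> \<Longrightarrow> \<phi> \<oplus>\<^bsub>D\<^esub> \<psi> \<in> carrier D"
    unfolding dual_iff[of "\<phi> \<oplus>\<^bsub>D\<^esub> \<psi>"]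
    by (simp add: ext dual_apply P.ract_closed Pm.a_closed dual_closed dual_add dual_ract A.l_distr A.a_ac)
  show "\<lbrakk>k \<in> carrier K; \<phi> \<in> carrier D\<rbrakk> \<Longrightarrow> k \<odot>\<^bsub>D\<^esub> \<phi> \<in> carrier D"
    unfolding dual_iff[of "k \<odot>\<^bsub>D\<^esub> \<phi>"]
    by (simp add: ext dual_apply P.ract_closed Pm.a_closed dual_closed dual_add dual_ract
        kA.smult_closed kA.smult_r_distr kA.smult_mult_l)
  show "\<lbrakk>a \<in> carrier A; \<phi> \<in> carrier D\<rbrakk> \<Longrightarrow> lact D a \<phi> \<in> carrier D"
    unfolding dual_iff[of "lact D a \<phi>"]
    by (simp add: ext dual_apply P.ract_closed Pm.a_closed dual_closed dual_add dual_ract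
        A.r_distr A.m_assoc)
  show "\<lbrakk>b \<in> carrier B; \<phi> \<in> carrier D\<rbrakk> \<Longrightarrow> ract D \<phi> b \<in> carrier D"
    unfolding dual_iff[of "ract D \<phi> b"]
    by (simp add: ext dual_apply P.ract_closed P.lact_closed Pm.a_closed dual_closed dual_add dual_ract
        P.lact_add_r P.lact_ract[symmetric])
qed

lemma bimodule_dual: "bimodule K A B D"
proof -
  note cl = dual_ops_closed dual_closed
  note app = dual_apply dual_closed
  have ab: "abelian_group D"
  proof (rule abelian_groupI)
    fix \<phi> assume \<phi>: "\<phi> \<in> carrier D"
    have k: "\<ominus>\<^bsub>K\<^esub> \<one>\<^bsub>K\<^esub> \<in> carrier K" by simp
    have "(\<ominus>\<^bsub>K\<^esub> \<one>\<^bsub>K\<^esub>) \<odot>\<^bsub>D\<^esub> \<phi> \<oplus>\<^bsub>D\<^esub> \<phi> = \<zero>\<^bsub>D\<^esub>"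
      by (rule dual_eqI)
        (use \<phi> k in \<open>simp_all add: cl app kA.smult_l_minus A.l_neg\<close>)
    then show "\<exists>\<psi>\<in>carrier D. \<psi> \<oplus>\<^bsub>D\<^esub> \<phi> = \<zero>\<^bsub>D\<^esub>" using cl(3)[OF k \<phi>] by blast
  qed (rule cl dual_eqI; simp add: cl app A.a_ac)+
  have mod: "module K D"
    by (rule moduleI[OF kA.R.is_cring ab]; (rule cl dual_eqI)?;
        simp add: cl app kA.smult_l_distr kA.smult_r_distr kA.smult_assoc1)
  show ?thesis
    by (intro bimodule.intro left_module.intro right_module.intro left_module_axioms.intro
        right_module_axioms.intro bimodule_axioms.intro algebra_A left_algebra mod; (rule cl dual_eqI)?;
        simp add: cl app kB.mult_closed kB.smult_closed P.lact_closed A.l_distr A.r_distr A.m_assoc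
          kA.smult_mult_l kA.smult_mult_r P.lact_add_l P.lact_assoc P.lact_smult_l dual_add dual_smult)
qed

lemma balanced_eval: "balanced K B D P A (\<lambda>\<phi> p. \<phi> p)"
  unfolding balanced_def
  by (simp add: dual_closed dual_apply dual_add dual_smult)

end

section \<open>The locally supported dual\<close>

locale locally_unital_bimodule =
  idempotent_local_units K B I e + right_unital_bimodule K B A P
  for K :: "'k ring" and B :: "('k, 'b) module" and I :: "'i set" and e :: "'i \<Rightarrow> 'b"
    and A :: "('k, 'a) module" and P :: "('k, 'b, 'p, 'a) bimod"
begin

interpretation A: ring A by (rule ring_A)
interpretation P: bimodule K B A P by (rule bimodule_P)

abbreviation "Q \<equiv> dagger A I e P"

lemma dagger_simps [simp]:
  "zero Q = zero D" "add Q = add D" "smult Q = smult D" "lact Q = lact D" "ract Q = ract D"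
  by (simp_all add: dagger_def)

text \<open>
  The double composite in the definition of \<open>P\<^sup>\<dagger>\<close> is the form \<open>p \<mapsto> \<phi>(e\<^sub>i p)\<close>.
\<close>

lemma dagger_iff:
  "\<phi> \<in> carrier Q \<longleftrightarrow> \<phi> \<in> carrier D \<and> (\<exists>i\<in>I. \<forall>p\<in>carrier P. \<phi> (lact P (e i) p) = \<phi> p)"
proof -
  have "\<phi> = compose (carrier P) (compose (carrier (corner_module P (e i))) \<phi> (corner_incl P (e i)))
      (corner_proj P (e i)) \<longleftrightarrow> (\<forall>p\<in>carrier P. \<phi> (lact P (e i) p) = \<phi> p)"
    if "\<phi> \<in> carrier D" for i
    using that
    by (auto simp: dual_iff fun_eq_iff compose_def corner_incl_def corner_module_def corner_proj_def
        extensional_def)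
  then show ?thesis by (auto simp: dagger_def)
qed

lemma dagger_subset: "carrier Q \<subseteq> carrier D"
  by (auto simp: dagger_iff)

lemma dagger_dual: "\<phi> \<in> carrier Q \<Longrightarrow> \<phi> \<in> carrier D"
  using dagger_subset by blast

text \<open>
  A form supported on \<open>e\<^sub>i\<close> is also supported on any \<open>e\<^sub>k\<close> that is a unit for \<open>e\<^sub>i\<close>, which gives closure
  under sums. If \<open>b e\<^sub>i = b\<close>, then \<open>\<phi> b\<close> is supported on \<open>e\<^sub>i\<close>, whatever the support of \<open>\<phi>\<close>.
\<close>

lemma bimodule_dagger: "bimodule K A B Q"
proof -
  have "bimodule K A B (D\<lparr>carrier := carrier Q\<rparr>)"
  proof (rule sub_bimodule[OF bimodule_dual dagger_subset])
    obtain i where i: "i \<in> I" using e_local[of "{}"] by auto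
    then show "\<zero>\<^bsub>D\<^esub> \<in> carrier Q"
      unfolding dagger_iff by (auto simp: dual_ops_closed dual_apply P.lact_closed e_closed)
  next
    fix \<phi> \<psi> assume "\<phi> \<in> carrier Q" "\<psi> \<in> carrier Q"
    then obtain i j where i: "\<phi> \<in> carrier D" "i \<in> I" "\<And>p. p \<in> carrier P \<Longrightarrow> \<phi> (lact P (e i) p) = \<phi> p"
      and j: "\<psi> \<in> carrier D" "j \<in> I" "\<And>p. p \<in> carrier P \<Longrightarrow> \<psi> (lact P (e j) p) = \<psi> p"
      unfolding dagger_iff by blast
    obtain k where k: "k \<in> I" "e i \<otimes>\<^bsub>B\<^esub> e k = e i" "e j \<otimes>\<^bsub>B\<^esub> e k = e j"
      using e_local[of "{e i, e j}"] i(2) j(2) e_closed by auto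
    have "\<phi> (lact P (e k) p) = \<phi> p" "\<psi> (lact P (e k) p) = \<psi> p" if "p \<in> carrier P" for p
      using i j k that e_closed P.lact_closed P.lact_assoc by metis+
    then show "\<phi> \<oplus>\<^bsub>D\<^esub> \<psi> \<in> carrier Q"
      unfolding dagger_iff using i(1) j(1) k(1)
      by (auto simp: dual_ops_closed dual_apply P.lact_closed e_closed intro!: bexI[of _ k])
  next
    fix k \<phi> assume k: "k \<in> carrier K" and "\<phi> \<in> carrier Q"
    then obtain i where "\<phi> \<in> carrier D" "i \<in> I" "\<forall>p\<in>carrier P. \<phi> (lact P (e i) p) = \<phi> p"
      unfolding dagger_iff by blast
    then show "k \<odot>\<^bsub>D\<^esub> \<phi> \<in> carrier Q"
      unfolding dagger_iff using k
      by (auto simp: dual_ops_closed dual_apply P.lact_closed e_closed intro!: bexI[of _ i])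
  next
    fix a \<phi> assume a: "a \<in> carrier A" and "\<phi> \<in> carrier Q"
    then obtain i where "\<phi> \<in> carrier D" "i \<in> I" "\<forall>p\<in>carrier P. \<phi> (lact P (e i) p) = \<phi> p"
      unfolding dagger_iff by blast
    then show "lact D a \<phi> \<in> carrier Q"
      unfolding dagger_iff using a
      by (auto simp: dual_ops_closed dual_apply P.lact_closed e_closed intro!: bexI[of _ i])
  next
    fix b \<phi> assume b: "b \<in> carrier B" and \<phi>: "\<phi> \<in> carrier Q"
    obtain i where i: "i \<in> I" "b \<otimes>\<^bsub>B\<^esub> e i = b"
      using e_local[of "{b}"] b by auto
    have "lact P b (lact P (e i) p) = lact P b p" if "p \<in> carrier P" for p
      using i b that e_closed P.lact_assoc by metis
    then show "ract D \<phi> b \<in> carrier Q"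
      using i(1) b \<phi> unfolding dagger_iff
      by (auto simp: dual_ops_closed dual_apply P.lact_closed e_closed intro!: bexI[of _ i])
  qed
  then show ?thesis by (simp add: dagger_def)
qed

lemma firm_dagger: "firm_bimodule K A B Q"
proof (rule firm_bimoduleI[OF bimodule_dagger local_units_unital[OF ring_A] local_units_B])
  fix \<phi> assume \<phi>: "\<phi> \<in> carrier Q"
  then have D: "\<phi> \<in> carrier D" by (simp add: dagger_iff)
  have "lact D \<one>\<^bsub>A\<^esub> \<phi> = \<phi>"
    by (rule dual_eqI) (use D in \<open>simp_all add: dual_ops_closed dual_apply dual_closed\<close>)
  then show "\<exists>u\<in>carrier A. lact Q u \<phi> = \<phi>" by auto
  obtain i where i: "i \<in> I" "\<And>p. p \<in> carrier P \<Longrightarrow> \<phi> (lact P (e i) p) = \<phi> p"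
    using \<phi> by (auto simp: dagger_iff)
  then have "ract D \<phi> (e i) = \<phi>"
    using D e_closed by (intro dual_eqI) (simp_all add: dual_ops_closed dual_apply)
  then show "\<exists>u\<in>carrier B. ract Q \<phi> u = \<phi>" using i(1) e_closed by auto
qed

lemma bimodule_pairs:
  shows pair_PQ: "bimodule_pair K B A B P Q" and pair_QP: "bimodule_pair K A B A Q P"
    and pair_DP: "bimodule_pair K A B A D P"
  by (intro bimodule_pair.intro bimodule_P bimodule_dagger bimodule_dual)+

interpretation PQ: bimodule_pair K B A B P Q by (rule pair_PQ)
interpretation QP: bimodule_pair K A B A Q P by (rule pair_QP)
interpretation DP: bimodule_pair K A B A D P by (rule pair_DP)

lemma eps_additive:
  shows "eps_map K B A P \<in> carrier (tensor K B Q P) \<rightarrow> carrier A"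
    and "\<lbrakk>x \<in> carrier (tensor K B Q P); y \<in> carrier (tensor K B Q P)\<rbrakk>
      \<Longrightarrow> eps_map K B A P (x \<oplus>\<^bsub>tensor K B Q P\<^esub> y) = eps_map K B A P x \<oplus>\<^bsub>A\<^esub> eps_map K B A P y"
    and eps_pure: "\<lbrakk>q \<in> carrier Q; p \<in> carrier P\<rbrakk> \<Longrightarrow> eps_map K B A P (pure K B Q P q p) = q p"
proof -
  have "balanced K B Q P (tensor K B D P) (pure K B D P)"
    unfolding balanced_def
    by (simp add: dagger_dual DP.pure_closed DP.pure_add_l DP.pure_add_r DP.pure_smult DP.pure_act)
  note i = QP.tensor_lift_additive[OF DP.abelian_group_tensor_schemes(1) this]
  note ev = DP.tensor_lift_additive[OF module.axioms(2)[OF k_algebra.axioms(1)[OF algebra_A]] balanced_eval]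
  note mem = funcset_mem[OF i(1)] funcset_mem[OF ev(1)]
  show "eps_map K B A P \<in> carrier (tensor K B Q P) \<rightarrow> carrier A"
    and "\<lbrakk>x \<in> carrier (tensor K B Q P); y \<in> carrier (tensor K B Q P)\<rbrakk>
      \<Longrightarrow> eps_map K B A P (x \<oplus>\<^bsub>tensor K B Q P\<^esub> y) = eps_map K B A P x \<oplus>\<^bsub>A\<^esub> eps_map K B A P y"
    and "\<lbrakk>q \<in> carrier Q; p \<in> carrier P\<rbrakk> \<Longrightarrow> eps_map K B A P (pure K B Q P q p) = q p"
    by (simp_all add: eps_map_def Pi_iff mem i(2,3) ev(2,3) dagger_dual)
qed

lemma eps_bimod_hom: "eps_map K B A P \<in> bimod_hom K A A (tensor K B Q P) (regular A)"
proof (rule QP.tensor_bimod_homI[OF bimodule_regular[OF algebra_A]])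
  interpret q: module K Q by (rule bimodule_module[OF bimodule_dagger])
  interpret Q: bimodule K A B Q by (rule bimodule_dagger)
  note cl = q.smult_closed[simplified] Q.lact_closed[simplified] P.ract_closed
  show "eps_map K B A P (pure K B Q P (k \<odot>\<^bsub>Q\<^esub> q) p) = k \<odot>\<^bsub>regular A\<^esub> eps_map K B A P (pure K B Q P q p)"
    if "k \<in> carrier K" "q \<in> carrier Q" "p \<in> carrier P" for k q p
    using that by (simp add: eps_pure cl dual_apply)
  show "eps_map K B A P (pure K B Q P (lact Q a q) p) = lact (regular A) a (eps_map K B A P (pure K B Q P q p))"
    if "a \<in> carrier A" "q \<in> carrier Q" "p \<in> carrier P" for a q p
    using that by (simp add: eps_pure cl dual_apply)
  show "eps_map K B A P (pure K B Q P q (ract P p a)) = ract (regular A) (eps_map K B A P (pure K B Q P q p)) a"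
    if "a \<in> carrier A" "q \<in> carrier Q" "p \<in> carrier P" for a q p
    using that by (simp add: eps_pure cl dual_ract dagger_dual)
qed (use eps_additive in auto)

end

section \<open>Dual bases\<close>

text \<open>
  Lift the identity of \<open>M\<close> along the surjection from the free module on a finite generating set; the
  coordinates of the lift are the forms of the dual basis.
\<close>

lemma dual_basis_exists:
  fixes M :: "('k, 'l, 'm, 'a) bimod"
  assumes fg: "right_fin_gen A M" and proj: "right_projective K A M"
  shows "\<exists>n z zs. dual_basis A M n z zs"
proof -
  have M: "unital_right_module K A M" using proj by (simp add: right_projective_def)
  interpret M: unital_right_module K A M by (rule M)
  obtain S where S: "finite S" "S \<subseteq> carrier M"
    "\<And>m. m \<in> carrier M \<Longrightarrow> \<exists>a\<in>S \<rightarrow> carrier A. m = (\<Oplus>\<^bsub>M\<^esub>s\<in>S. ract M s (a s))"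
    using fg unfolding right_fin_gen_def by blast
  let ?F = "free_right A S :: ('k, 'l, 'm \<Rightarrow> 'a, 'a) bimod"
  let ?g = "lin_ext A M (\<lambda>x. x)"
  have F: "unital_right_module K A ?F"
    by (rule free_right_unital[OF M.k_algebra_axioms M.ring_R])
  have g: "?g \<in> right_hom A ?F M" by (rule lin_right_hom[OF M]) (use S in auto)
  have gS: "?g u = (\<Oplus>\<^bsub>M\<^esub>s\<in>S. ract M s (u s))" if "u \<in> carrier ?F" for u
    by (rule lin_superset[OF M _ that]) (use S that in \<open>auto simp: free_right_def\<close>)
  have onto: "?g ` carrier ?F = carrier M"
  proof
    show "?g ` carrier ?F \<subseteq> carrier M" using g by (auto simp: right_hom_def)
    show "carrier M \<subseteq> ?g ` carrier ?F"
    proof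
      fix m assume m: "m \<in> carrier M"
      obtain a where a: "a \<in> S \<rightarrow> carrier A" "m = (\<Oplus>\<^bsub>M\<^esub>s\<in>S. ract M s (a s))" using S(3)[OF m] by blast
      let ?u = "\<lambda>x. if x \<in> S then a x else \<zero>\<^bsub>A\<^esub>"
      have zA: "\<zero>\<^bsub>A\<^esub> \<in> carrier A" using M.ring_R by (rule ring.ring_simprules(2))
      have u: "?u \<in> carrier ?F"
      proof -
        have "finite {x. ?u x \<noteq> \<zero>\<^bsub>A\<^esub>}" by (rule finite_subset[OF _ S(1)]) auto
        moreover have "?u x \<in> carrier A" for x using funcset_mem[OF a(1), of x] zA by simp
        ultimately show ?thesis unfolding free_right_def by simp
      qed
      have "?g ?u = (\<Oplus>\<^bsub>M\<^esub>s\<in>S. ract M s (?u s))" by (rule gS[OF u])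
      also have "\<dots> = (\<Oplus>\<^bsub>M\<^esub>s\<in>S. ract M s (a s))"
        by (rule M.M.finsum_cong') (use a S in \<open>auto intro!: M.ract_closed\<close>)
      also have "\<dots> = m" by (rule a(2)[symmetric])
      finally show "m \<in> ?g ` carrier ?F" by (rule image_eqI[OF sym u])
    qed
  qed
  have "(\<lambda>x. x) \<in> right_hom A M M" by (auto simp: right_hom_def)
  from right_projective_lift[OF proj F M g onto this]
  obtain h where h: "h \<in> right_hom A M ?F" "\<And>m. m \<in> carrier M \<Longrightarrow> ?g (h m) = m" by blast
  have hF: "h m \<in> carrier ?F" if "m \<in> carrier M" for m using h(1) that by (auto simp: right_hom_def)
  obtain z where z: "bij_betw z {..<card S} S"
    using ex_bij_betw_nat_finite[OF S(1)] by (auto simp: lessThan_atLeast0)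
  define zs where "zs j = (\<lambda>m\<in>carrier M. h m (z j))" for j
  have zsA: "zs j m \<in> carrier A" if "m \<in> carrier M" for j m
    using hF[OF that] that by (simp add: zs_def free_right_def)
  have "dual_basis A M (card S) z zs"
    unfolding dual_basis_def
  proof (intro conjI allI impI ballI)
    fix j assume "j < card S"
    then show "z j \<in> carrier M" using z S(2) by (auto simp: bij_betw_def)
    have "zs j (x \<oplus>\<^bsub>M\<^esub> y) = zs j x \<oplus>\<^bsub>A\<^esub> zs j y" if "x \<in> carrier M" "y \<in> carrier M" for x y
      using that h(1) by (auto simp: zs_def right_hom_def free_right_def)
    moreover have "zs j (ract M x a) = zs j x \<otimes>\<^bsub>A\<^esub> a" if "x \<in> carrier M" "a \<in> carrier A" for x a
      using that h(1) M.ract_closed by (auto simp: zs_def right_hom_def free_right_def)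
    moreover have "zs j \<in> extensional (carrier M)" by (simp add: zs_def)
    ultimately show "zs j \<in> carrier (dual A M)"
      using zsA by (auto simp: dual_def right_hom_def)
  next
    fix m assume m: "m \<in> carrier M"
    have c: "(\<lambda>s. ract M s (h m s)) \<in> z ` {..<card S} \<rightarrow> carrier M"
      using z S(2) hF[OF m] by (auto simp: bij_betw_def free_right_def intro!: M.ract_closed)
    have "m = (\<Oplus>\<^bsub>M\<^esub>s\<in>z ` {..<card S}. ract M s (h m s))"
      using h(2)[OF m] gS[OF hF[OF m]] z by (simp add: bij_betw_def)
    also have "\<dots> = (\<Oplus>\<^bsub>M\<^esub>j\<in>{..<card S}. ract M (z j) (h m (z j)))"
      by (rule M.M.finsum_reindex[OF c]) (use z in \<open>simp add: bij_betw_def\<close>)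
    also have "\<dots> = (\<Oplus>\<^bsub>M\<^esub>j\<in>{..<card S}. ract M (z j) (zs j m))"
      by (simp add: zs_def m)
    finally show "m = (\<Oplus>\<^bsub>M\<^esub>j\<in>{..<card S}. ract M (z j) (zs j m))" .
  qed
  then show ?thesis by blast
qed

section \<open>Casimir elements\<close>

locale locally_projective_bimodule = locally_unital_bimodule K B I e A P
  for K :: "'k ring" and B :: "('k, 'b) module" and I :: "'i set" and e :: "'i \<Rightarrow> 'b"
    and A :: "('k, 'a) module" and P :: "('k, 'b, 'p, 'a) bimod" +
  assumes corner_fg: "i \<in> I \<Longrightarrow> right_fin_gen A (corner_module P (e i))"
    and corner_projective: "i \<in> I \<Longrightarrow> right_projective K A (corner_module P (e i))"
begin

interpretation kB: k_algebra K B by (rule algebra_B)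
interpretation A: ring A by (rule ring_A)
interpretation Pm: module K P by (rule bimodule_module[OF bimodule_P])
interpretation P: bimodule K B A P by (rule bimodule_P)
interpretation Qm: module K Q by (rule bimodule_module[OF bimodule_dagger])
interpretation Q: bimodule K A B Q by (rule bimodule_dagger)
interpretation PQ: bimodule_pair K B A B P Q by (rule pair_PQ)

abbreviation "T \<equiv> tensor K A P Q"
abbreviation "t \<equiv> pure K A P Q"

interpretation T: abelian_group T by (rule PQ.abelian_group_tensor_schemes)

text \<open>
  What becomes of the dual basis property when the forms on \<open>uP\<close> are pulled back to \<open>P\<close>: a dual
  basis of \<open>uP\<close> expressed with elements and forms of the ambient modules, so that families
  belonging to different corners can be compared inside \<open>P \<otimes>\<^sub>A P\<^sup>\<dagger>\<close>.
\<close>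

definition resolves :: "'b \<Rightarrow> nat \<Rightarrow> (nat \<Rightarrow> 'p) \<Rightarrow> (nat \<Rightarrow> 'p \<Rightarrow> 'a) \<Rightarrow> bool" where
  "resolves u n z q \<longleftrightarrow> u \<in> carrier B \<and> (\<forall>j<n. z j \<in> carrier P \<and> q j \<in> carrier Q) \<and>
     (\<forall>p\<in>carrier P. lact P u p = (\<Oplus>\<^bsub>P\<^esub>j\<in>{..<n}. ract P (z j) (q j p)))"

text \<open>
  The element \<open>b \<cdot> (\<Sum> z\<^sub>j \<otimes> q\<^sub>j)\<close>, where \<open>\<Sum> z\<^sub>j \<otimes> q\<^sub>j\<close> is the analogue of the Casimir (dual basis)
  element of a finitely generated projective module.
\<close>

definition casimir :: "nat \<Rightarrow> (nat \<Rightarrow> 'p) \<Rightarrow> (nat \<Rightarrow> 'p \<Rightarrow> 'a) \<Rightarrow> 'b \<Rightarrow> ('p \<times> ('p \<Rightarrow> 'a) \<Rightarrow>\<^sub>0 int) set" where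
  "casimir n z q b = (\<Oplus>\<^bsub>T\<^esub>j\<in>{..<n}. t (lact P b (z j)) (q j))"

lemma additive_casimir:
  assumes "abelian_group G" "h \<in> carrier T \<rightarrow> carrier G"
    and "\<And>x y. \<lbrakk>x \<in> carrier T; y \<in> carrier T\<rbrakk> \<Longrightarrow> h (x \<oplus>\<^bsub>T\<^esub> y) = h x \<oplus>\<^bsub>G\<^esub> h y"
    and "b \<in> carrier B" "resolves u n z q"
  shows "h (casimir n z q b) = (\<Oplus>\<^bsub>G\<^esub>j\<in>{..<n}. h (t (lact P b (z j)) (q j)))"
  unfolding casimir_def
  by (rule additive_finsum[OF T.abelian_group_axioms assms(1-3)])
    (use assms(4,5) in \<open>auto simp: resolves_def PQ.pure_closed P.lact_closed\<close>)

lemma casimir_closed: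
  assumes "b \<in> carrier B" "resolves u n z q"
  shows "casimir n z q b \<in> carrier T"
  using assms unfolding casimir_def resolves_def
  by (auto intro!: T.finsum_closed PQ.pure_closed P.lact_closed)

lemma dagger_finsum_apply:
  assumes "finite U" "\<And>x. x \<in> U \<Longrightarrow> q x \<in> carrier Q" "p \<in> carrier P"
  shows "(\<Oplus>\<^bsub>Q\<^esub>x\<in>U. q x) p = (\<Oplus>\<^bsub>A\<^esub>x\<in>U. q x p)"
  by (rule additive_finsum[where h = "\<lambda>\<phi>. \<phi> p", OF bimodule_abelian_group[OF bimodule_dagger] A.is_abelian_group])
    (use assms in \<open>auto simp: dual_apply intro!: dual_closed dest: dagger_dual\<close>)

text \<open>
  The key identity: \<open>c\<close>, regarded as a map from \<open>uP\<close> to \<open>vP\<close>, can be expanded in the family of either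
  its source or its target. This is the familiar fact that the image of the dual basis element does
  not depend on the basis, in a form that moves \<open>c\<close> from the left factor to the right one.
\<close>

lemma casimir_transfer:
  assumes zq: "resolves u n z q" and wr: "resolves v m w r" and c: "c \<in> carrier B"
    and vc: "v \<otimes>\<^bsub>B\<^esub> c = c" and cu: "c \<otimes>\<^bsub>B\<^esub> u = c"
  shows "casimir n z q c = (\<Oplus>\<^bsub>T\<^esub>l\<in>{..<m}. t (w l) (ract D (r l) c))"
proof -
  have u: "u \<in> carrier B" and v: "v \<in> carrier B" using zq wr by (simp_all add: resolves_def)
  have z: "z j \<in> carrier P" "q j \<in> carrier Q" if "j < n" for j using zq that by (simp_all add: resolves_def)
  have w: "w l \<in> carrier P" "r l \<in> carrier Q" if "l < m" for l using wr that by (simp_all add: resolves_def)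
  have cz: "lact P c (z j) \<in> carrier P" if "j < n" for j using c z(1)[OF that] by (rule P.lact_closed)
  define a where "a l j = r l (lact P c (z j))" for l j
  have a: "a l j \<in> carrier A" if "l < m" "j < n" for l j
    unfolding a_def using that by (intro dual_closed dagger_dual w(2) cz)
  have aq: "lact D (a l j) (q j) \<in> carrier Q" if "l < m" "j < n" for l j
    using Q.lact_closed[OF a[OF that] z(2)[OF that(2)]] by simp
  \<comment> \<open>The scalars of the expansion of \<open>c z\<^sub>j\<close> cross the tensor sign.\<close>
  have expand: "t (lact P c (z j)) (q j) = (\<Oplus>\<^bsub>T\<^esub>l\<in>{..<m}. t (w l) (lact D (a l j) (q j)))"
    if j: "j < n" for j
  proof -
    have "lact P c (z j) = lact P v (lact P c (z j))"
      using P.lact_assoc[OF v c z(1)[OF j]] vc by simp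
    also have "\<dots> = (\<Oplus>\<^bsub>P\<^esub>l\<in>{..<m}. ract P (w l) (a l j))"
      using wr cz[OF j] by (simp add: resolves_def a_def)
    finally have "t (lact P c (z j)) (q j) = t (\<Oplus>\<^bsub>P\<^esub>l\<in>{..<m}. ract P (w l) (a l j)) (q j)" by simp
    also have "\<dots> = (\<Oplus>\<^bsub>T\<^esub>l\<in>{..<m}. t (ract P (w l) (a l j)) (q j))"
      by (rule additive_finsum[where h = "\<lambda>x. t x (q j)", OF abelian_P T.abelian_group_axioms])
        (use j z w a in \<open>auto simp: PQ.pure_closed PQ.pure_add_l P.ract_closed\<close>)
    also have "\<dots> = (\<Oplus>\<^bsub>T\<^esub>l\<in>{..<m}. t (w l) (lact D (a l j) (q j)))"
      by (rule T.finsum_cong')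
        (use j z w a aq PQ.pure_act in \<open>auto intro!: PQ.pure_closed\<close>)
    finally show ?thesis .
  qed
  \<comment> \<open>Summing over \<open>j\<close> first evaluates \<open>r\<^sub>l\<close> on \<open>c u p = c p\<close>.\<close>
  have collapse: "(\<Oplus>\<^bsub>Q\<^esub>j\<in>{..<n}. lact D (a l j) (q j)) = ract D (r l) c" if l: "l < m" for l
  proof (rule dual_eqI)
    have s: "(\<Oplus>\<^bsub>Q\<^esub>j\<in>{..<n}. lact D (a l j) (q j)) \<in> carrier Q"
      using aq[OF l] by (intro Qm.finsum_closed) auto
    show "(\<Oplus>\<^bsub>Q\<^esub>j\<in>{..<n}. lact D (a l j) (q j)) \<in> carrier D" by (rule dagger_dual[OF s])
    have rD: "r l \<in> carrier D" using w(2)[OF l] by (rule dagger_dual)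
    show "ract D (r l) c \<in> carrier D" using c rD by (rule dual_ops_closed)
    fix p assume p: "p \<in> carrier P"
    have qA: "q j p \<in> carrier A" if "j < n" for j using dual_closed[OF dagger_dual[OF z(2)[OF that]] p] .
    have zr: "ract P (z j) (q j p) \<in> carrier P" if "j < n" for j
      using P.ract_closed[OF qA[OF that] z(1)[OF that]] .
    have "(\<Oplus>\<^bsub>Q\<^esub>j\<in>{..<n}. lact D (a l j) (q j)) p = (\<Oplus>\<^bsub>A\<^esub>j\<in>{..<n}. lact D (a l j) (q j) p)"
      by (rule dagger_finsum_apply) (use aq l p in auto)
    also have "\<dots> = (\<Oplus>\<^bsub>A\<^esub>j\<in>{..<n}. r l (lact P c (ract P (z j) (q j p))))"
    proof (rule A.finsum_cong')
      show "(\<lambda>j. r l (lact P c (ract P (z j) (q j p)))) \<in> {..<n} \<rightarrow> carrier A"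
        using rD c zr by (auto intro!: dual_closed P.lact_closed)
      fix j assume "j \<in> {..<n}"
      then have j: "j < n" by simp
      have "r l (lact P c (ract P (z j) (q j p))) = r l (ract P (lact P c (z j)) (q j p))"
        using P.lact_ract[OF c z(1)[OF j] qA[OF j]] by simp
      then show "lact D (a l j) (q j) p = r l (lact P c (ract P (z j) (q j p)))"
        using dual_ract[OF rD cz[OF j] qA[OF j]] by (simp add: dual_apply p a_def)
    qed simp
    also have "\<dots> = r l (lact P c (\<Oplus>\<^bsub>P\<^esub>j\<in>{..<n}. ract P (z j) (q j p)))"
      by (rule additive_finsum[where h = "\<lambda>x. r l (lact P c x)", OF abelian_P A.is_abelian_group, symmetric])
        (use rD c zr in \<open>auto intro!: dual_closed P.lact_closed simp: P.lact_add_r dual_add P.lact_closed\<close>)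
    also have "\<dots> = r l (lact P c (lact P u p))"
      using zq p by (simp add: resolves_def)
    also have "\<dots> = ract D (r l) c p"
      using P.lact_assoc[OF c u p] cu p by (simp add: dual_apply)
    finally show "(\<Oplus>\<^bsub>Q\<^esub>j\<in>{..<n}. lact D (a l j) (q j)) p = ract D (r l) c p" .
  qed
  have "casimir n z q c = (\<Oplus>\<^bsub>T\<^esub>j\<in>{..<n}. \<Oplus>\<^bsub>T\<^esub>l\<in>{..<m}. t (w l) (lact D (a l j) (q j)))"
    unfolding casimir_def
    by (rule T.finsum_cong') (use expand w aq in \<open>auto intro!: T.finsum_closed PQ.pure_closed\<close>)
  also have "\<dots> = (\<Oplus>\<^bsub>T\<^esub>l\<in>{..<m}. \<Oplus>\<^bsub>T\<^esub>j\<in>{..<n}. t (w l) (lact D (a l j) (q j)))"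
    by (rule finsum_swap[OF T.abelian_group_axioms]) (use w aq in \<open>auto intro!: PQ.pure_closed\<close>)
  also have "\<dots> = (\<Oplus>\<^bsub>T\<^esub>l\<in>{..<m}. t (w l) (ract D (r l) c))"
  proof (rule T.finsum_cong')
    show "(\<lambda>l. t (w l) (ract D (r l) c)) \<in> {..<m} \<rightarrow> carrier T"
      using w Q.ract_closed[OF c] by (auto intro!: PQ.pure_closed)
    fix l assume "l \<in> {..<m}"
    then have l: "l < m" by simp
    have "(\<Oplus>\<^bsub>T\<^esub>j\<in>{..<n}. t (w l) (lact D (a l j) (q j))) = t (w l) (\<Oplus>\<^bsub>Q\<^esub>j\<in>{..<n}. lact D (a l j) (q j))"
      by (rule additive_finsum[where h = "\<lambda>y. t (w l) y", OF bimodule_abelian_group[OF bimodule_dagger]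
            T.abelian_group_axioms, symmetric])
        (use w(1)[OF l] aq[OF l] PQ.pure_add_r in \<open>auto intro!: PQ.pure_closed\<close>)
    then show "(\<Oplus>\<^bsub>T\<^esub>j\<in>{..<n}. t (w l) (lact D (a l j) (q j))) = t (w l) (ract D (r l) c)"
      by (simp add: collapse[OF l])
  qed simp
  finally show ?thesis .
qed

section \<open>The map \<open>\<eta>\<close>\<close>

lemma corner_iff:
  assumes "i \<in> I"
  shows "b \<in> carrier (corner B (e i)) \<longleftrightarrow> b \<in> carrier B \<and> e i \<otimes>\<^bsub>B\<^esub> b = b \<and> b \<otimes>\<^bsub>B\<^esub> e i = b"
proof
  note e = e_closed[OF assms] e_idem[OF assms]
  show "b \<in> carrier B \<and> e i \<otimes>\<^bsub>B\<^esub> b = b \<and> b \<otimes>\<^bsub>B\<^esub> e i = b" if "b \<in> carrier (corner B (e i))"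
  proof -
    obtain x where x: "x \<in> carrier B" "b = e i \<otimes>\<^bsub>B\<^esub> x \<otimes>\<^bsub>B\<^esub> e i" using \<open>b \<in> _\<close> by (auto simp: corner_def)
    have "e i \<otimes>\<^bsub>B\<^esub> (e i \<otimes>\<^bsub>B\<^esub> (x \<otimes>\<^bsub>B\<^esub> e i)) = e i \<otimes>\<^bsub>B\<^esub> (x \<otimes>\<^bsub>B\<^esub> e i)"
      using e x kB.mult_assoc[of "e i" "e i" "x \<otimes>\<^bsub>B\<^esub> e i"] by (simp add: kB.mult_closed)
    then show ?thesis using x e by (simp add: kB.mult_closed kB.mult_assoc)
  qed
  show "b \<in> carrier (corner B (e i))" if "b \<in> carrier B \<and> e i \<otimes>\<^bsub>B\<^esub> b = b \<and> b \<otimes>\<^bsub>B\<^esub> e i = b"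
    using that by (auto simp: corner_def intro!: image_eqI[of _ _ b])
qed

abbreviation "coform i \<phi> \<equiv> compose (carrier P) \<phi> (corner_proj P (e i))"

text \<open>
  The sum in the dual basis property is formed in the corner; as the inclusion of the corner is
  additive, it may be read in \<open>P\<close>.
\<close>

lemma dual_basis_resolves:
  assumes i: "i \<in> I" and zs: "dual_basis A (corner_module P (e i)) n z zs"
  shows "resolves (e i) n z (\<lambda>j. coform i (zs j))"
proof -
  let ?M = "corner_module P (e i)"
  note ei = e_closed[OF i]
  have M: "unital_right_module K A ?M"
    using corner_projective[OF i] by (simp add: right_projective_def)
  interpret M: unital_right_module K A ?M by (rule M)
  have cM: "carrier ?M = lact P (e i) ` carrier P" by (simp add: corner_module_def)
  have ops: "add ?M = add P" "ract ?M = ract P" "zero ?M = zero P" by (simp_all add: corner_module_def)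
  have sub: "carrier ?M \<subseteq> carrier P" using P.lact_closed[OF ei] by (auto simp: cM)
  have emem: "lact P (e i) p \<in> carrier ?M" if "p \<in> carrier P" for p using that by (auto simp: cM)
  have idem: "lact P (e i) (lact P (e i) p) = lact P (e i) p" if "p \<in> carrier P" for p
    using P.lact_assoc[OF ei ei that] e_idem[OF i] by simp
  have app: "coform i \<phi> p = \<phi> (lact P (e i) p)" if "p \<in> carrier P" for \<phi> p
    using that by (simp add: compose_def corner_proj_def)
  have z: "z j \<in> carrier ?M" if "j < n" for j using zs that by (simp add: dual_basis_def)
  have zsD: "zs j \<in> carrier (dual A ?M)" if "j < n" for j using zs that by (simp add: dual_basis_def)
  have zsA: "zs j x \<in> carrier A" if "j < n" "x \<in> carrier ?M" for j x
    using zsD[OF that(1)] that(2) by (auto simp: dual_def right_hom_def)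
  have q: "coform i (zs j) \<in> carrier Q" if "j < n" for j
    unfolding dagger_iff
  proof (intro conjI bexI[OF _ i] ballI)
    show "coform i (zs j) \<in> carrier D"
      unfolding dual_iff using zsD[OF that] ei emem
      by (auto simp: app dual_def right_hom_def ops Pm.a_closed P.ract_closed P.lact_add_r P.lact_ract[symmetric]
          compose_extensional)
    show "coform i (zs j) (lact P (e i) p) = coform i (zs j) p" if "p \<in> carrier P" for p
      using that ei by (simp add: app P.lact_closed idem)
  qed
  have "lact P (e i) p = (\<Oplus>\<^bsub>P\<^esub>j\<in>{..<n}. ract P (z j) (coform i (zs j) p))" if p: "p \<in> carrier P" for p
  proof -
    have c: "ract P (z j) (zs j (lact P (e i) p)) \<in> carrier ?M" if "j < n" for j
      using M.ract_closed[OF zsA[OF that emem[OF p]] z[OF that]] by (simp add: ops)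
    have "lact P (e i) p = (\<Oplus>\<^bsub>?M\<^esub>j\<in>{..<n}. ract P (z j) (zs j (lact P (e i) p)))"
      using zs emem[OF p] by (simp add: dual_basis_def ops)
    also have "\<dots> = (\<Oplus>\<^bsub>P\<^esub>j\<in>{..<n}. ract P (z j) (zs j (lact P (e i) p)))"
      by (rule additive_finsum[where h = "\<lambda>x. x", OF _ abelian_P])
        (use sub c M.M.abelian_group_axioms in \<open>auto simp: ops\<close>)
    finally show ?thesis using p by (simp add: app)
  qed
  then show ?thesis
    using ei q z sub by (auto simp: resolves_def)
qed

text \<open>
  The inclusion of the corner can be dropped from the formula because \<open>b z\<^sub>j = e\<^sub>i (b z\<^sub>j)\<close> already lies
  in it.
\<close>

lemma eta_formula_casimir:
  "eta_formula K B A I e P \<eta> \<longleftrightarrow> (\<forall>i\<in>I. \<forall>b\<in>carrier (corner B (e i)). \<forall>n z zs.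
     dual_basis A (corner_module P (e i)) n z zs \<longrightarrow> \<eta> b = casimir n z (\<lambda>j. coform i (zs j)) b)"
proof -
  have "(\<Oplus>\<^bsub>T\<^esub>j\<in>{..<n}. t (corner_incl P (e i) (lact P b (z j))) (coform i (zs j)))
      = casimir n z (\<lambda>j. coform i (zs j)) b"
    if i: "i \<in> I" and b: "b \<in> carrier (corner B (e i))"
      and zs: "dual_basis A (corner_module P (e i)) n z zs" for i b n z zs
  proof -
    note r = dual_basis_resolves[OF i zs]
    have b: "b \<in> carrier B" "e i \<otimes>\<^bsub>B\<^esub> b = b" using b corner_iff[OF i] by auto
    have incl: "corner_incl P (e i) (lact P b (z j)) = lact P b (z j)" if "j < n" for j
    proof -
      have zP: "z j \<in> carrier P" using r that by (simp add: resolves_def)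
      have "lact P b (z j) = lact P (e i) (lact P b (z j))"
        using P.lact_assoc[OF e_closed[OF i] b(1) zP] b(2) by simp
      then show ?thesis using P.lact_closed[OF b(1) zP] by (auto simp: corner_incl_def corner_module_def)
    qed
    show ?thesis unfolding casimir_def
      by (rule T.finsum_cong') (use r b incl in \<open>auto simp: resolves_def intro!: PQ.pure_closed P.lact_closed\<close>)
  qed
  then show ?thesis unfolding eta_formula_def by auto
qed

lemma common_corner:
  assumes "finite X" "X \<subseteq> carrier B"
  obtains i n z zs where "i \<in> I" "X \<subseteq> carrier (corner B (e i))"
    "dual_basis A (corner_module P (e i)) n z zs"
proof -
  obtain i where i: "i \<in> I" "\<forall>b\<in>X. e i \<otimes>\<^bsub>B\<^esub> b = b \<and> b \<otimes>\<^bsub>B\<^esub> e i = b"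
    using e_local[OF assms] by blast
  moreover have "X \<subseteq> carrier (corner B (e i))" using i assms(2) by (auto simp: corner_iff)
  ultimately show thesis
    using that dual_basis_exists[OF corner_fg corner_projective, of i] by blast
qed

text \<open>
  Since \<open>b = e\<^sub>j b e\<^sub>i\<close>, the transfer identity rewrites the first sum in terms of the second family; since
  also \<open>b = e\<^sub>j b e\<^sub>j\<close>, it does the same to the second sum, with the same outcome.
\<close>

lemma casimir_unique:
  assumes i: "i \<in> I" "b \<in> carrier (corner B (e i))" "dual_basis A (corner_module P (e i)) n z zs"
    and j: "j \<in> I" "b \<in> carrier (corner B (e j))" "dual_basis A (corner_module P (e j)) m w ws"
  shows "casimir n z (\<lambda>l. coform i (zs l)) b = casimir m w (\<lambda>l. coform j (ws l)) b"
proof -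
  note zi = dual_basis_resolves[OF i(1,3)] and wj = dual_basis_resolves[OF j(1,3)]
  have b: "b \<in> carrier B" "b \<otimes>\<^bsub>B\<^esub> e i = b" "e j \<otimes>\<^bsub>B\<^esub> b = b" "b \<otimes>\<^bsub>B\<^esub> e j = b"
    using i(2) j(2) corner_iff[OF i(1)] corner_iff[OF j(1)] by auto
  show ?thesis using casimir_transfer[OF zi wj b(1,3,2)] casimir_transfer[OF wj wj b(1,3,4)] by simp
qed

text \<open>
  The values are prescribed by a relation that is total, because every \<open>b\<close> lies in some corner, and
  single-valued by the previous lemma.
\<close>

lemma eta_exists_unique:
  "\<exists>!\<eta>. \<eta> \<in> carrier B \<rightarrow>\<^sub>E carrier T \<and> eta_formula K B A I e P \<eta>"
proof (rule ex_ex1I)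
  define val where "val b x \<longleftrightarrow> (\<exists>i n z zs. i \<in> I \<and> b \<in> carrier (corner B (e i)) \<and>
    dual_basis A (corner_module P (e i)) n z zs \<and> x = casimir n z (\<lambda>j. coform i (zs j)) b)" for b x
  have val_fun: "x = y" if "val b x" "val b y" for b x y
    using that casimir_unique unfolding val_def by blast
  have val_ex: "\<exists>x. val b x" if "b \<in> carrier B" for b
    using common_corner[of "{b}"] that unfolding val_def by (metis empty_subsetI finite.emptyI finite.insertI insert_subset)
  define \<eta> where "\<eta> = (\<lambda>b\<in>carrier B. SOME x. val b x)"
  have \<eta>: "val b (\<eta> b)" if "b \<in> carrier B" for b
    using someI_ex[OF val_ex[OF that]] that by (simp add: \<eta>_def)
  have "\<eta> b \<in> carrier T" if "b \<in> carrier B" for b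
    using \<eta>[OF that] that casimir_closed dual_basis_resolves unfolding val_def by metis
  moreover have "\<eta> b = casimir n z (\<lambda>j. coform i (zs j)) b"
    if "i \<in> I" "b \<in> carrier (corner B (e i))" "dual_basis A (corner_module P (e i)) n z zs" for i b n z zs
  proof (rule val_fun[OF \<eta>])
    show "b \<in> carrier B" using that corner_iff by blast
    show "val b (casimir n z (\<lambda>j. coform i (zs j)) b)" unfolding val_def using that by blast
  qed
  ultimately show "\<exists>\<eta>. \<eta> \<in> carrier B \<rightarrow>\<^sub>E carrier T \<and> eta_formula K B A I e P \<eta>"
    unfolding eta_formula_casimir by (intro exI[of _ \<eta>]) (auto simp: \<eta>_def)
next
  fix \<eta> \<theta> assume \<eta>: "\<eta> \<in> carrier B \<rightarrow>\<^sub>E carrier T \<and> eta_formula K B A I e P \<eta>"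
    and \<theta>: "\<theta> \<in> carrier B \<rightarrow>\<^sub>E carrier T \<and> eta_formula K B A I e P \<theta>"
  show "\<eta> = \<theta>"
  proof (rule PiE_ext[of _ "carrier B" "\<lambda>_. carrier T"])
    fix b assume "b \<in> carrier B"
    then have X: "finite {b}" "{b} \<subseteq> carrier B" by simp_all
    obtain i n z zs where "i \<in> I" "{b} \<subseteq> carrier (corner B (e i))"
      "dual_basis A (corner_module P (e i)) n z zs" by (rule common_corner[OF X])
    then show "\<eta> b = \<theta> b" using \<eta> \<theta> unfolding eta_formula_casimir by simp
  qed (use \<eta> \<theta> in blast)+
qed

text \<open>
  On a finite set of elements, and on everything else in the same corner (such as their sums and
  products), \<open>\<eta>\<close> is computed by one family.
\<close>

lemma eta_casimir:
  assumes "eta_formula K B A I e P \<eta>" "finite X" "X \<subseteq> carrier B"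
  shows "\<exists>u n z q. resolves u n z q \<and> (\<forall>b\<in>X. u \<otimes>\<^bsub>B\<^esub> b = b \<and> b \<otimes>\<^bsub>B\<^esub> u = b) \<and>
    (\<forall>b\<in>carrier B. u \<otimes>\<^bsub>B\<^esub> b = b \<and> b \<otimes>\<^bsub>B\<^esub> u = b \<longrightarrow> \<eta> b = casimir n z q b)"
proof -
  obtain i n z zs where i: "i \<in> I" "X \<subseteq> carrier (corner B (e i))"
    "dual_basis A (corner_module P (e i)) n z zs" using common_corner assms by blast
  have "resolves (e i) n z (\<lambda>j. coform i (zs j))" by (rule dual_basis_resolves[OF i(1,3)])
  moreover have "\<forall>b\<in>X. e i \<otimes>\<^bsub>B\<^esub> b = b \<and> b \<otimes>\<^bsub>B\<^esub> e i = b" using i corner_iff by blast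
  moreover have "\<forall>b\<in>carrier B. e i \<otimes>\<^bsub>B\<^esub> b = b \<and> b \<otimes>\<^bsub>B\<^esub> e i = b
      \<longrightarrow> \<eta> b = casimir n z (\<lambda>j. coform i (zs j)) b"
    using assms(1) i corner_iff[OF i(1)] unfolding eta_formula_casimir by blast
  ultimately show ?thesis by blast
qed

text \<open>
  Additivity, \<open>K\<close>-linearity and left linearity can be read off the formula with a common corner for
  the elements involved. For right linearity \<open>b\<close> has to be moved to the right factor first, by the
  transfer identity for a single family.
\<close>

lemma eta_bimod_hom:
  assumes \<eta>: "eta_formula K B A I e P \<eta>"
  shows "\<eta> \<in> bimod_hom K B B (regular B) T"
proof -
  have closed: "\<eta> b \<in> carrier T" if b: "b \<in> carrier B" for b
  proof -
    have X: "finite {b}" "{b} \<subseteq> carrier B" using b by simp_all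
    obtain u n z q where "resolves u n z q" "\<forall>x\<in>{b}. u \<otimes>\<^bsub>B\<^esub> x = x \<and> x \<otimes>\<^bsub>B\<^esub> u = x"
      "\<forall>x\<in>carrier B. u \<otimes>\<^bsub>B\<^esub> x = x \<and> x \<otimes>\<^bsub>B\<^esub> u = x \<longrightarrow> \<eta> x = casimir n z q x"
      using eta_casimir[OF \<eta> X] by blast
    then show ?thesis using casimir_closed b by simp
  qed
  have add: "\<eta> (b \<oplus>\<^bsub>B\<^esub> b') = \<eta> b \<oplus>\<^bsub>T\<^esub> \<eta> b'" if b: "b \<in> carrier B" "b' \<in> carrier B" for b b'
  proof -
    have X: "finite {b, b'}" "{b, b'} \<subseteq> carrier B" using b by simp_all
    obtain u n z q where r: "resolves u n z q"
      and u: "\<forall>x\<in>{b, b'}. u \<otimes>\<^bsub>B\<^esub> x = x \<and> x \<otimes>\<^bsub>B\<^esub> u = x"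
      and eq: "\<forall>x\<in>carrier B. u \<otimes>\<^bsub>B\<^esub> x = x \<and> x \<otimes>\<^bsub>B\<^esub> u = x \<longrightarrow> \<eta> x = casimir n z q x"
      using eta_casimir[OF \<eta> X] by blast
    have uB: "u \<in> carrier B" using r by (simp add: resolves_def)
    have bb: "b \<oplus>\<^bsub>B\<^esub> b' \<in> carrier B" "u \<otimes>\<^bsub>B\<^esub> (b \<oplus>\<^bsub>B\<^esub> b') = b \<oplus>\<^bsub>B\<^esub> b'" "(b \<oplus>\<^bsub>B\<^esub> b') \<otimes>\<^bsub>B\<^esub> u = b \<oplus>\<^bsub>B\<^esub> b'"
      using b uB u by (simp_all add: kB.mult_l_distr kB.mult_r_distr)
    have zq: "z j \<in> carrier P" "q j \<in> carrier Q" if "j < n" for j using r that by (simp_all add: resolves_def)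
    have "casimir n z q (b \<oplus>\<^bsub>B\<^esub> b') = (\<Oplus>\<^bsub>T\<^esub>j\<in>{..<n}. t (lact P b (z j)) (q j) \<oplus>\<^bsub>T\<^esub> t (lact P b' (z j)) (q j))"
      unfolding casimir_def using b zq
      by (intro T.finsum_cong') (auto simp: P.lact_add_l PQ.pure_add_l P.lact_closed intro!: PQ.pure_closed)
    also have "\<dots> = casimir n z q b \<oplus>\<^bsub>T\<^esub> casimir n z q b'"
      unfolding casimir_def using b zq by (intro T.finsum_addf) (auto intro!: PQ.pure_closed P.lact_closed)
    finally show ?thesis using eq bb u b by simp
  qed
  have smult: "\<eta> (k \<odot>\<^bsub>B\<^esub> b) = k \<odot>\<^bsub>T\<^esub> \<eta> b" if k: "k \<in> carrier K" and b: "b \<in> carrier B" for k b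
  proof -
    have X: "finite {b}" "{b} \<subseteq> carrier B" using b by simp_all
    obtain u n z q where r: "resolves u n z q"
      and u: "\<forall>x\<in>{b}. u \<otimes>\<^bsub>B\<^esub> x = x \<and> x \<otimes>\<^bsub>B\<^esub> u = x"
      and eq: "\<forall>x\<in>carrier B. u \<otimes>\<^bsub>B\<^esub> x = x \<and> x \<otimes>\<^bsub>B\<^esub> u = x \<longrightarrow> \<eta> x = casimir n z q x"
      using eta_casimir[OF \<eta> X] by blast
    have uB: "u \<in> carrier B" using r by (simp add: resolves_def)
    have kb: "k \<odot>\<^bsub>B\<^esub> b \<in> carrier B" "u \<otimes>\<^bsub>B\<^esub> (k \<odot>\<^bsub>B\<^esub> b) = k \<odot>\<^bsub>B\<^esub> b" "(k \<odot>\<^bsub>B\<^esub> b) \<otimes>\<^bsub>B\<^esub> u = k \<odot>\<^bsub>B\<^esub> b"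
      using b k uB u by (simp_all add: kB.smult_closed kB.smult_mult_l kB.smult_mult_r)
    have zq: "z j \<in> carrier P" "q j \<in> carrier Q" if "j < n" for j using r that by (simp_all add: resolves_def)
    have "k \<odot>\<^bsub>T\<^esub> casimir n z q b = (\<Oplus>\<^bsub>T\<^esub>j\<in>{..<n}. k \<odot>\<^bsub>T\<^esub> t (lact P b (z j)) (q j))"
      by (rule additive_casimir[OF T.abelian_group_axioms _ _ b r])
        (use k in \<open>auto simp: PQ.tensor_smult_closed PQ.tensor_smult_add\<close>)
    also have "\<dots> = casimir n z q (k \<odot>\<^bsub>B\<^esub> b)"
      unfolding casimir_def using b k kb(1) zq
      by (intro T.finsum_cong')
        (auto simp: P.lact_smult_l PQ.tensor_smult_pure P.lact_closed Pm.smult_closed intro!: PQ.pure_closed)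
    finally show ?thesis using eq kb u b by simp
  qed
  have lact: "\<eta> (b \<otimes>\<^bsub>B\<^esub> b') = lact T b (\<eta> b')" and ract: "\<eta> (b \<otimes>\<^bsub>B\<^esub> b') = ract T (\<eta> b) b'"
    if b: "b \<in> carrier B" "b' \<in> carrier B" for b b'
  proof -
    have X: "finite {b, b'}" "{b, b'} \<subseteq> carrier B" using b by simp_all
    obtain u n z q where r: "resolves u n z q"
      and u: "\<forall>x\<in>{b, b'}. u \<otimes>\<^bsub>B\<^esub> x = x \<and> x \<otimes>\<^bsub>B\<^esub> u = x"
      and eq: "\<forall>x\<in>carrier B. u \<otimes>\<^bsub>B\<^esub> x = x \<and> x \<otimes>\<^bsub>B\<^esub> u = x \<longrightarrow> \<eta> x = casimir n z q x"
      using eta_casimir[OF \<eta> X] by blast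
    have uB: "u \<in> carrier B" using r by (simp add: resolves_def)
    have bb: "b \<otimes>\<^bsub>B\<^esub> b' \<in> carrier B" "u \<otimes>\<^bsub>B\<^esub> (b \<otimes>\<^bsub>B\<^esub> b') = b \<otimes>\<^bsub>B\<^esub> b'" "(b \<otimes>\<^bsub>B\<^esub> b') \<otimes>\<^bsub>B\<^esub> u = b \<otimes>\<^bsub>B\<^esub> b'"
      using b uB u kB.mult_assoc[of u b b'] by (simp_all add: kB.mult_closed kB.mult_assoc)
    have zq: "z j \<in> carrier P" "q j \<in> carrier Q" if "j < n" for j using r that by (simp_all add: resolves_def)
    have "lact T b (casimir n z q b') = (\<Oplus>\<^bsub>T\<^esub>j\<in>{..<n}. lact T b (t (lact P b' (z j)) (q j)))"
      by (rule additive_casimir[OF T.abelian_group_axioms _ _ b(2) r])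
        (use b in \<open>auto simp: PQ.tensor_lact_closed PQ.tensor_lact_add\<close>)
    also have "\<dots> = casimir n z q (b \<otimes>\<^bsub>B\<^esub> b')"
      unfolding casimir_def using b bb(1) zq
      by (intro T.finsum_cong') (auto simp: P.lact_assoc PQ.tensor_lact_pure P.lact_closed intro!: PQ.pure_closed)
    finally show "\<eta> (b \<otimes>\<^bsub>B\<^esub> b') = lact T b (\<eta> b')" using eq bb u b by simp
    have rc: "ract D (q j) c \<in> carrier Q" if "j < n" "c \<in> carrier B" for j c
      using Q.ract_closed[OF that(2) zq(2)[OF that(1)]] by simp
    have "ract T (casimir n z q b) b' = ract T (\<Oplus>\<^bsub>T\<^esub>j\<in>{..<n}. t (z j) (ract D (q j) b)) b'"
      using casimir_transfer[OF r r b(1)] u by simp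
    also have "\<dots> = (\<Oplus>\<^bsub>T\<^esub>j\<in>{..<n}. ract T (t (z j) (ract D (q j) b)) b')"
      by (rule additive_finsum[where h = "\<lambda>x. ract T x b'", OF T.abelian_group_axioms T.abelian_group_axioms])
        (use b zq rc in \<open>auto simp: PQ.tensor_ract_closed PQ.tensor_ract_add intro!: PQ.pure_closed\<close>)
    also have "\<dots> = (\<Oplus>\<^bsub>T\<^esub>j\<in>{..<n}. t (z j) (ract D (q j) (b \<otimes>\<^bsub>B\<^esub> b')))"
    proof (rule T.finsum_cong')
      fix j assume "j \<in> {..<n}"
      then have j: "j < n" by simp
      show "ract T (t (z j) (ract D (q j) b)) b' = t (z j) (ract D (q j) (b \<otimes>\<^bsub>B\<^esub> b'))"
        using PQ.tensor_ract_pure[OF b(2) zq(1)[OF j] rc[OF j b(1)]] Q.ract_assoc[OF b zq(2)[OF j]] by simp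
    qed (use zq rc bb in \<open>auto intro!: PQ.pure_closed\<close>)
    also have "\<dots> = casimir n z q (b \<otimes>\<^bsub>B\<^esub> b')"
      using casimir_transfer[OF r r bb] by simp
    finally show "\<eta> (b \<otimes>\<^bsub>B\<^esub> b') = ract T (\<eta> b) b'" using eq bb u b by simp
  qed
  show ?thesis
    unfolding bimod_hom_def using closed add smult lact ract by simp
qed

section \<open>The axioms of the context\<close>

lemma balanced_zigzag_P:
  assumes p: "p \<in> carrier P"
  shows "balanced K A P Q P (\<lambda>x y. ract P x (eps_map K B A P (pure K B Q P y p)))"
  using p Qm.a_closed Qm.smult_closed Q.lact_closed dual_closed[OF dagger_dual] unfolding balanced_def
  by (simp add: eps_pure P.ract_closed P.ract_add_l P.ract_add_r dual_apply P.ract_smult_l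
      P.ract_smult_r P.ract_assoc)

lemma balanced_zigzag_Q:
  assumes q: "q \<in> carrier Q"
  shows "balanced K A P Q Q (\<lambda>x y. lact Q (eps_map K B A P (pure K B Q P q x)) y)"
  using q Qm.a_closed Qm.smult_closed Q.lact_closed Q.lact_add_l Q.lact_add_r Q.lact_smult_l Q.lact_smult_r Q.lact_assoc
    dual_closed[OF dagger_dual] unfolding balanced_def
  by (simp add: eps_pure dual_add dagger_dual dual_smult dual_ract P.ract_closed Pm.smult_closed)

text \<open>
  Both identities come from \<open>b p = b u p = \<Sum> b z\<^sub>j q\<^sub>j(p)\<close>, once read in \<open>P\<close> and once after applying a
  form \<open>q\<close>.
\<close>

lemma zigzag:
  assumes \<eta>: "eta_formula K B A I e P \<eta>" and b: "b \<in> carrier B"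
  shows zigzag_P: "p \<in> carrier P \<Longrightarrow>
      tensor_lift P (\<lambda>x y. ract P x (eps_map K B A P (pure K B Q P y p))) (\<eta> b) = lact P b p"
    and zigzag_Q: "q \<in> carrier Q \<Longrightarrow>
      tensor_lift Q (\<lambda>x y. lact Q (eps_map K B A P (pure K B Q P q x)) y) (\<eta> b) = ract Q q b"
proof -
  have X: "finite {b}" "{b} \<subseteq> carrier B" using b by simp_all
  obtain u n z zs where r: "resolves u n z zs"
    and u: "\<forall>x\<in>{b}. u \<otimes>\<^bsub>B\<^esub> x = x \<and> x \<otimes>\<^bsub>B\<^esub> u = x"
    and eq: "\<forall>x\<in>carrier B. u \<otimes>\<^bsub>B\<^esub> x = x \<and> x \<otimes>\<^bsub>B\<^esub> u = x \<longrightarrow> \<eta> x = casimir n z zs x"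
    using eta_casimir[OF \<eta> X] by blast
  have uB: "u \<in> carrier B" using r by (simp add: resolves_def)
  have eta: "\<eta> b = casimir n z zs b" using eq u b by simp
  have zq: "z j \<in> carrier P" "zs j \<in> carrier Q" if "j < n" for j using r that by (simp_all add: resolves_def)
  have bz: "lact P b (z j) \<in> carrier P" if "j < n" for j using b zq(1)[OF that] by (rule P.lact_closed)
  have expand: "lact P b p = (\<Oplus>\<^bsub>P\<^esub>j\<in>{..<n}. ract P (lact P b (z j)) (zs j p))" if p: "p \<in> carrier P" for p
  proof -
    have A: "zs j p \<in> carrier A" if "j < n" for j using dual_closed[OF dagger_dual[OF zq(2)[OF that]] p] .
    have "lact P b p = lact P b (lact P u p)"
      using P.lact_assoc[OF b uB p] u by simp
    also have "\<dots> = lact P b (\<Oplus>\<^bsub>P\<^esub>j\<in>{..<n}. ract P (z j) (zs j p))"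
      using r p by (simp add: resolves_def)
    also have "\<dots> = (\<Oplus>\<^bsub>P\<^esub>j\<in>{..<n}. lact P b (ract P (z j) (zs j p)))"
      by (rule additive_finsum[where h = "lact P b", OF abelian_P abelian_P])
        (use b zq A in \<open>auto simp: P.lact_closed P.ract_closed P.lact_add_r\<close>)
    also have "\<dots> = (\<Oplus>\<^bsub>P\<^esub>j\<in>{..<n}. ract P (lact P b (z j)) (zs j p))"
      by (rule Pm.finsum_cong') (use b zq A bz in \<open>auto simp: P.lact_ract intro!: P.ract_closed P.lact_closed\<close>)
    finally show ?thesis .
  qed
  show "tensor_lift P (\<lambda>x y. ract P x (eps_map K B A P (pure K B Q P y p))) (\<eta> b) = lact P b p"
    if p: "p \<in> carrier P"
  proof -
    note l = PQ.tensor_lift_additive[OF abelian_P balanced_zigzag_P[OF p]]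
    let ?h = "tensor_lift P (\<lambda>x y. ract P x (eps_map K B A P (pure K B Q P y p)))"
    have "?h (\<eta> b) = (\<Oplus>\<^bsub>P\<^esub>j\<in>{..<n}. ?h (t (lact P b (z j)) (zs j)))"
      unfolding eta by (rule additive_casimir[OF abelian_P l(1,2) b r])
    also have "\<dots> = (\<Oplus>\<^bsub>P\<^esub>j\<in>{..<n}. ract P (lact P b (z j)) (zs j p))"
      by (rule Pm.finsum_cong')
        (use zq bz p in \<open>auto simp: l(3) eps_pure intro!: P.ract_closed dual_closed[OF dagger_dual]\<close>)
    finally show ?thesis using expand[OF p] by simp
  qed
  show "tensor_lift Q (\<lambda>x y. lact Q (eps_map K B A P (pure K B Q P q x)) y) (\<eta> b) = ract Q q b"
    if q: "q \<in> carrier Q"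
  proof -
    let ?h = "tensor_lift Q (\<lambda>x y. lact Q (eps_map K B A P (pure K B Q P q x)) y)"
    have abQ: "abelian_group Q" by (rule bimodule_abelian_group[OF bimodule_dagger])
    note l = PQ.tensor_lift_additive[OF abQ balanced_zigzag_Q[OF q]]
    have qD: "q \<in> carrier D" using q by (rule dagger_dual)
    have qA: "q (lact P b (z j)) \<in> carrier A" if "j < n" for j using dual_closed[OF qD bz[OF that]] .
    have cl: "lact D (q (lact P b (z j))) (zs j) \<in> carrier Q" if "j < n" for j
      using Q.lact_closed[OF qA[OF that] zq(2)[OF that]] by simp
    have "?h (\<eta> b) = (\<Oplus>\<^bsub>Q\<^esub>j\<in>{..<n}. ?h (t (lact P b (z j)) (zs j)))"
      unfolding eta by (rule additive_casimir[OF abQ l(1,2) b r])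
    also have "\<dots> = (\<Oplus>\<^bsub>Q\<^esub>j\<in>{..<n}. lact D (q (lact P b (z j))) (zs j))"
      by (rule Qm.finsum_cong') (use zq bz q cl l(3) in \<open>auto simp: eps_pure\<close>)
    also have "\<dots> = ract D q b"
    proof (rule dual_eqI)
      show "(\<Oplus>\<^bsub>Q\<^esub>j\<in>{..<n}. lact D (q (lact P b (z j))) (zs j)) \<in> carrier D"
        using cl by (intro dagger_dual Qm.finsum_closed) auto
      show "ract D q b \<in> carrier D" using b qD by (rule dual_ops_closed)
      fix p assume p: "p \<in> carrier P"
      have A: "zs j p \<in> carrier A" if "j < n" for j using dual_closed[OF dagger_dual[OF zq(2)[OF that]] p] .
      have bzr: "ract P (lact P b (z j)) (zs j p) \<in> carrier P" if "j < n" for j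
        using P.ract_closed[OF A[OF that] bz[OF that]] .
      have "(\<Oplus>\<^bsub>Q\<^esub>j\<in>{..<n}. lact D (q (lact P b (z j))) (zs j)) p
          = (\<Oplus>\<^bsub>A\<^esub>j\<in>{..<n}. lact D (q (lact P b (z j))) (zs j) p)"
        by (rule dagger_finsum_apply) (use cl p in auto)
      also have "\<dots> = (\<Oplus>\<^bsub>A\<^esub>j\<in>{..<n}. q (ract P (lact P b (z j)) (zs j p)))"
        by (rule A.finsum_cong')
          (use p qD bz A bzr in \<open>auto simp: dual_apply dual_ract dual_closed\<close>)
      also have "\<dots> = q (\<Oplus>\<^bsub>P\<^esub>j\<in>{..<n}. ract P (lact P b (z j)) (zs j p))"
        by (rule additive_finsum[where h = q, OF abelian_P A.is_abelian_group, symmetric])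
          (use qD bzr in \<open>auto simp: dual_add dual_closed\<close>)
      also have "\<dots> = ract D q b p" using expand[OF p] p by (simp add: dual_apply)
      finally show "(\<Oplus>\<^bsub>Q\<^esub>j\<in>{..<n}. lact D (q (lact P b (z j))) (zs j)) p = ract D q b p" .
    qed
    finally show ?thesis by simp
  qed
qed

end

theorem proposition4p15:
  fixes K :: "'k ring"
    and A :: "('k, 'a) module"
    and B :: "('k, 'b) module"
    and I :: "'i set" and e :: "'i \<Rightarrow> 'b"
    and P :: "('k, 'b, 'p, 'a) bimod"
  assumes "cring K"
    and "k_algebra K A" and "ring A"
    and "idempotent_local_units K B I e"
    and "firm_bimodule K B A P"
    and "\<forall>i\<in>I. right_fin_gen A (corner_module P (e i)) \<and> right_projective K A (corner_module P (e i))"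
  shows "(\<exists>!\<eta>. \<eta> \<in> carrier B \<rightarrow>\<^sub>E carrier (tensor K A P (dagger A I e P)) \<and>
              eta_formula K B A I e P \<eta>) \<and>
         (\<forall>\<eta>. eta_formula K B A I e P \<eta> \<longrightarrow>
              comatrix_coring_context K B A P (dagger A I e P) \<eta> (eps_map K B A P))"
proof -
  have P: "bimodule K B A P" using assms(5) by (simp add: firm_bimodule_def)
  interpret locally_projective_bimodule K B I e A P
    by (intro locally_projective_bimodule.intro locally_unital_bimodule.intro right_unital_bimodule.intro
        locally_projective_bimodule_axioms.intro assms(3,4) P firm_right_unital[OF assms(5,3)])
      (use assms(6) in auto)
  have "comatrix_coring_context K B A P Q \<eta> (eps_map K B A P)" if "eta_formula K B A I e P \<eta>" for \<eta>
    by (intro comatrix_coring_context.intro firm_algebraI algebra_B local_units_B assms(2,5)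
        local_units_unital[OF assms(3)] firm_dagger eta_bimod_hom[OF that] eps_bimod_hom
        zigzag_P[OF that] zigzag_Q[OF that])
  then show ?thesis using eta_exists_unique by blast
qed

end
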